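(* Let $\beta\equiv\beta^{(2n)}$ be an $N$-dimensional real sequence, and suppose its moment matrix $\mathcal{M}(n)\equiv\mathcal{M}(n)(\beta)$ is positive semidefinite and admits a flat extension $\mathcal{M}(n+1)$. Let $r:=\operatorname{rank}\mathcal{M}(n)$ and $\mathcal{V}:=\mathcal{V}(\mathcal{M}(n+1))$. Then $\operatorname{card}\mathcal{V}=r$, and $\mathcal{V}\equiv\{v_j\}_{j=1}^r$ forms the support of the unique representing measure $\mu$ for $\mathcal{M}(n+1)$. If $\mathcal{B}\equiv\{T^{i_k}\}_{k=1}^r$ is a maximal linearly independent subset of columns of $\mathcal{M}(n)$, and $W_{\mathcal{B},\mathcal{V}}$ denotes the $r\times r$ matrix whose entry in row $k$, column $j$ is $v_j^{i_k}$ $(1\le k,j\le r)$, then $W_{\mathcal{B},\mathcal{V}}$ is invertible, and $\mu=\sum_{j=1}^r\rho_j\delta_{v_j}$, where $\rho\equiv(\rho_1,\dots,\rho_r)$ is uniquely determined by $\rho^t=W_{\mathcal{B},\mathcal{V}}^{-1}(\beta_{i_1},\dots,\beta_{i_r})^t$.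
   Context: For $i\in\mathbb{Z}_+^N$, $|i|=i_1+\dots+i_N$ and $t^i=t_1^{i_1}\cdots t_N^{i_N}$. A real sequence $\beta^{(2n)}$ is $\{\beta_i\}_{i\in\mathbb{Z}_+^N,|i|\le 2n}$ with $\beta_i\in\mathbb{R}$. Its moment matrix $\mathcal{M}(n)(\beta)$ has rows and columns indexed by $\{i\in\mathbb{Z}_+^N:|i|\le n\}$ with entry $\beta_{i+j}$ in row $i$, column $j$; the column with index $j$ is denoted $T^j$. For a real polynomial $p=\sum_{|i|\le n}a_it^i$, put $p(T):=\sum_{|i|\le n}a_iT^i$ (an element of the column space of $\mathcal{M}(n)$). The variety of $\mathcal{M}(n)$ is $\mathcal{V}(\mathcal{M}(n)):=\bigcap\{\mathcal{Z}(p): p\in\mathbb{R}[t_1,\dots,t_N],\ \deg p\le n,\ p(T)=0\}$, where $\mathcal{Z}(p)=\{t\in\mathbb{R}^N:p(t)=0\}$; $\mathcal{V}(\mathcal{M}(n+1))$ is defined in the same way with $n+1$ in place of $n$. An extension $\mathcal{M}(n+1)$ of $\mathcal{M}(n)(\beta)$ is a moment matrix $\mathcal{M}(n+1)(\tilde\beta)$, with $\tilde\beta=\tilde\beta^{(2n+2)}$ a real sequence extending $\beta$; it is flat if $\operatorname{rank}\mathcal{M}(n+1)=\operatorname{rank}\mathcal{M}(n)$. A representing measure for $\mathcal{M}(n+1)(\tilde\beta)$ is a positive Borel measure $\mu$ on $\mathbb{R}^N$ with $\tilde\beta_i=\int t^i\,d\mu$ (convergent) for all $|i|\le 2n+2$.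 *)

theory Defs
  imports "Jordan_Normal_Form.Gauss_Jordan_Elimination" "HOL-Analysis.Analysis" "HOL-Analysis.Finite_Function_Topology"
begin

(* "$" is the component of a vector of type real^'n or nat^'n; entries of
   Jordan_Normal_Form vectors are written with vec_index. *)
no_notation vec_index (infixl \<open>$\<close> 100)

definition mdeg :: "nat ^ 'n \<Rightarrow> nat" where
  "mdeg i = (\<Sum>k\<in>UNIV. i $ k)"

definition multi_indices :: "nat \<Rightarrow> (nat ^ 'n) set" where
  "multi_indices n = {i. mdeg i \<le> n}"

lemma finite_multi_indices: "finite (multi_indices n :: (nat ^ 'n) set)"
proof (rule finite_subset)
  show "(multi_indices n :: (nat ^ 'n) set) \<subseteq> vec_lambda ` (PiE UNIV (\<lambda>_. {..n}))"
  proof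
    fix i :: "nat ^ 'n"
    assume "i \<in> multi_indices n"
    then have le: "(\<Sum>k\<in>UNIV. i $ k) \<le> n"
      by (simp add: multi_indices_def mdeg_def)
    have "vec_nth i k \<le> n" for k
      using member_le_sum[of k UNIV "vec_nth i"] le by simp
    then have "vec_nth i \<in> PiE UNIV (\<lambda>_. {..n})"
      by (intro PiE_I) simp_all
    then show "i \<in> vec_lambda ` (PiE UNIV (\<lambda>_. {..n}))"
      by (rule rev_image_eqI) (simp only: vec_nth_inverse)
  qed
  show "finite (vec_lambda ` (PiE UNIV (\<lambda>_. {..n})) :: (nat ^ 'n) set)"
    by (intro finite_imageI finite_PiE) auto
qed

definition monomial :: "nat ^ 'n \<Rightarrow> real ^ 'n \<Rightarrow> real" where
  "monomial i t = (\<Prod>k\<in>UNIV. (t $ k) ^ (i $ k))"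

text \<open>A real polynomial in the variables indexed by \<open>'n\<close> is its finitely supported family
  of coefficients.\<close>

type_synonym 'n mpoly_real = "(nat ^ 'n) \<Rightarrow>\<^sub>0 real"

definition deg_le :: "('n::finite) mpoly_real \<Rightarrow> nat \<Rightarrow> bool" where
  "deg_le p n \<longleftrightarrow> (\<forall>i\<in>Poly_Mapping.keys p. mdeg i \<le> n)"

definition eval_poly :: "('n::finite) mpoly_real \<Rightarrow> real ^ 'n \<Rightarrow> real" where
  "eval_poly p t = (\<Sum>i\<in>Poly_Mapping.keys p. Poly_Mapping.lookup p i * monomial i t)"

text \<open>A sequence \<open>\<beta>\<close> of degree \<open>2n\<close> is a function on all multi-indices of which only the values
  at multi-indices of degree at most \<open>2n\<close> matter: nothing below that concerns \<open>M(n)(\<beta>)\<close> looks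
  at other values. The rows and columns of \<open>M(n)(\<beta>)\<close> are indexed by \<open>multi_indices n\<close>.\<close>

definition moment_matrix :: "(nat ^ 'n \<Rightarrow> real) \<Rightarrow> nat ^ 'n \<Rightarrow> nat ^ 'n \<Rightarrow> real" where
  "moment_matrix \<beta> i j = \<beta> (i + j)"

definition psd_on :: "'i set \<Rightarrow> ('i \<Rightarrow> 'i \<Rightarrow> real) \<Rightarrow> bool" where
  "psd_on I A \<longleftrightarrow> (\<forall>i\<in>I. \<forall>j\<in>I. A i j = A j i) \<and>
     (\<forall>x. 0 \<le> (\<Sum>i\<in>I. \<Sum>j\<in>I. x i * A i j * x j))"

text \<open>The column \<open>T\<^sup>j\<close> of \<open>M(n)(\<beta>)\<close>, extended by 0 outside the row indices. This makes the columns
  elements of the library's real vector space of finitely supported functions, so that \<open>dim\<close>,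
  \<open>span\<close> and \<open>independent\<close> apply to them.\<close>

lift_definition moment_column :: "nat \<Rightarrow> (nat ^ 'n \<Rightarrow> real) \<Rightarrow> nat ^ 'n \<Rightarrow> (nat ^ 'n) \<Rightarrow>\<^sub>0 real" is
  "\<lambda>n \<beta> j i. if i \<in> multi_indices n then moment_matrix \<beta> i j else 0"
  by (rule finite_subset[OF _ finite_multi_indices]) auto

definition moment_columns :: "nat \<Rightarrow> (nat ^ 'n \<Rightarrow> real) \<Rightarrow> ((nat ^ 'n) \<Rightarrow>\<^sub>0 real) set" where
  "moment_columns n \<beta> = moment_column n \<beta> ` multi_indices n"

definition moment_rank :: "nat \<Rightarrow> (nat ^ 'n \<Rightarrow> real) \<Rightarrow> nat" where
  "moment_rank n \<beta> = dim (moment_columns n \<beta>)"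

text \<open>The element \<open>p(T) = \<Sum>j. a\<^sub>j T\<^sup>j\<close> of the column space of \<open>M(n)(\<beta>)\<close>, for \<open>deg p \<le> n\<close>.\<close>

definition column_comb :: "nat \<Rightarrow> (nat ^ 'n \<Rightarrow> real) \<Rightarrow> 'n mpoly_real \<Rightarrow> (nat ^ 'n) \<Rightarrow>\<^sub>0 real" where
  "column_comb n \<beta> p = (\<Sum>j\<in>Poly_Mapping.keys p. Poly_Mapping.lookup p j *\<^sub>R moment_column n \<beta> j)"

definition moment_variety :: "nat \<Rightarrow> (nat ^ 'n \<Rightarrow> real) \<Rightarrow> (real ^ 'n) set" where
  "moment_variety n \<beta> = \<Inter> {{t. eval_poly p t = 0} | p. deg_le p n \<and> column_comb n \<beta> p = 0}"

definition flat_extension :: "nat \<Rightarrow> (nat ^ 'n \<Rightarrow> real) \<Rightarrow> (nat ^ 'n \<Rightarrow> real) \<Rightarrow> bool" where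
  "flat_extension n \<beta> \<beta>' \<longleftrightarrow> (\<forall>i\<in>multi_indices (2 * n). \<beta>' i = \<beta> i) \<and>
     moment_rank (n + 1) \<beta>' = moment_rank n \<beta>"

text \<open>With indices counted from 0: the family \<open>T\<^bsup>i 0\<^esup>, \<dots>, T\<^bsup>i (r-1)\<^esup>\<close> lists without repetition
  a maximal linearly independent subset of the columns of \<open>M(n)(\<beta>)\<close>.\<close>

definition max_indep_columns ::
  "nat \<Rightarrow> (nat ^ 'n \<Rightarrow> real) \<Rightarrow> nat \<Rightarrow> (nat \<Rightarrow> nat ^ 'n) \<Rightarrow> bool" where
  "max_indep_columns n \<beta> r i \<longleftrightarrow> (\<forall>k<r. i k \<in> multi_indices n) \<and>
     inj_on (\<lambda>k. moment_column n \<beta> (i k)) {..<r} \<and>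
     (let B = (\<lambda>k. moment_column n \<beta> (i k)) ` {..<r}
      in independent B \<and>
         (\<forall>C. B \<subseteq> C \<and> C \<subseteq> moment_columns n \<beta> \<and> independent C \<longrightarrow> C = B))"

definition representing_measure ::
  "nat \<Rightarrow> (nat ^ 'n \<Rightarrow> real) \<Rightarrow> (real ^ 'n) measure \<Rightarrow> bool" where
  "representing_measure n \<beta> \<mu> \<longleftrightarrow> sets \<mu> = sets borel \<and>
     (\<forall>i\<in>multi_indices (2 * n). integrable \<mu> (monomial i) \<and> \<beta> i = integral\<^sup>L \<mu> (monomial i))"

definition measure_support :: "'a::topological_space measure \<Rightarrow> 'a set" where
  "measure_support \<mu> = {x. \<forall>U. open U \<and> x \<in> U \<longrightarrow> emeasure \<mu> U > 0}"

text \<open>The measure \<open>\<Sum>j<r. \<rho>\<^sub>j \<delta>\<^bsub>v j\<^esub>\<close> on the Borel sets. It is meant for \<open>\<rho>\<close> with nonnegative entries: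
  \<open>ennreal\<close> truncates negative numbers to 0.\<close>

definition atomic_measure :: "nat \<Rightarrow> real Matrix.vec \<Rightarrow> (nat \<Rightarrow> real ^ 'n) \<Rightarrow> (real ^ 'n) measure" where
  "atomic_measure r \<rho> v =
     measure_of UNIV (sets borel) (\<lambda>A. \<Sum>j<r. ennreal (vec_index \<rho> j) * indicator A (v j))"

lemma sets_atomic_measure: "sets (atomic_measure r \<rho> v) = sets borel"
  unfolding atomic_measure_def
  by (subst sets_measure_of) (simp_all add: sets.sigma_sets_eq[of borel, simplified])

lemma emeasure_atomic_measure:
  fixes v :: "nat \<Rightarrow> real ^ 'n"
  assumes "A \<in> sets borel"
  shows "emeasure (atomic_measure r \<rho> v) A = (\<Sum>j<r. ennreal (vec_index \<rho> j) * indicator A (v j))"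
proof (rule emeasure_measure_of[OF atomic_measure_def])
  let ?\<mu> = "\<lambda>A. \<Sum>j<r. ennreal (vec_index \<rho> j) * indicator A (v j)"
  show "countably_additive (sets (atomic_measure r \<rho> v)) ?\<mu>"
  proof (rule countably_additiveI)
    fix F :: "nat \<Rightarrow> (real ^ 'n) set"
    assume F: "disjoint_family F"
    have "suminf (\<lambda>m. ?\<mu> (F m)) = (\<Sum>j<r. suminf (\<lambda>m. ennreal (vec_index \<rho> j) * indicator (F m) (v j)))"
      by (rule suminf_sum) auto
    also have "\<dots> = ?\<mu> (\<Union> (range F))"
      by (simp add: suminf_indicator[OF F])
    finally show "suminf (\<lambda>m. ?\<mu> (F m)) = ?\<mu> (\<Union> (range F))" .
  qed
  show "sets borel \<subseteq> Pow (UNIV :: (real ^ 'n) set)"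
    by simp
  show "positive (sets (atomic_measure r \<rho> v)) ?\<mu>"
    by (simp add: positive_def)
  show "A \<in> sets (atomic_measure r \<rho> v)"
    using assms by (simp add: sets_atomic_measure)
qed

text \<open>The matrix whose entry in row \<open>k\<close> and column \<open>j\<close> is \<open>v\<^sub>j\<close> to the power \<open>i\<^sub>k\<close>, rows and columns
  counted from 0.\<close>

definition W_matrix :: "nat \<Rightarrow> (nat \<Rightarrow> nat ^ 'n) \<Rightarrow> (nat \<Rightarrow> real ^ 'n) \<Rightarrow> real Matrix.mat" where
  "W_matrix r i v = Matrix.mat r r (\<lambda>(k, j). monomial (i k) (v j))"

end

theory Submission
  imports
    Defs
    "Jordan_Normal_Form.Determinant"
    "HOL-Computational_Algebra.Fundamental_Theorem_Algebra"
begin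

text \<open>
  Let \<open>L\<close> be the Riesz functional of \<open>M(n+1)\<close> and \<open>\<langle>p, q\<rangle> = L(pq)\<close>. Flatness says that every \<open>p\<close> of
  degree at most \<open>n + 1\<close> is congruent, modulo the kernel of \<open>M(n+1)\<close>, to some \<open>q\<close> of degree at most
  \<open>n\<close>, and that \<open>p\<close> lies in that kernel as soon as it is orthogonal to all polynomials of degree at
  most \<open>n\<close>. Hence the form is positive definite on an \<open>r\<close>-dimensional space \<open>S\<close> of polynomials of
  degree at most \<open>n\<close> complementary to the kernel, and multiplication by the variables induces
  commuting self-adjoint operators on \<open>S\<close>. An orthonormal basis of joint eigenvectors \<open>h\<close> with
  joint eigenvalues \<open>v\<^sub>h\<close> gives \<open>p \<equiv> \<Sum>\<^sub>h p(v\<^sub>h) L(h) h\<close>, so \<open>L(h) h\<close> are the Lagrange interpolation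
  polynomials of the nodes \<open>v\<^sub>h\<close>, \<open>L(pq) = \<Sum>\<^sub>h L(h)\<^sup>2 p(v\<^sub>h) q(v\<^sub>h)\<close>, and the nodes form the variety.
  Any representing measure integrates the square of a polynomial vanishing on the variety to 0,
  so it lives on the variety, where the interpolation polynomials read off its weights.
\<close>

section \<open>Joint eigenbases of commuting self-adjoint operators\<close>

lemma poly_of_real_poly:
  "poly (map_poly of_real p) (of_real x :: 'a::real_field) = of_real (poly p x)"
  by (induction p) (simp_all add: map_poly_pCons)

lemma poly_of_real_poly_add:
  "poly (map_poly of_real (p + q)) (z :: 'a::real_field)
    = poly (map_poly of_real p) z + poly (map_poly of_real q) z"
  by (induction p q rule: poly_induct2) (simp_all add: map_poly_pCons algebra_simps)

lemma poly_of_real_poly_mult: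
  "poly (map_poly of_real (p * q)) (z :: 'a::real_field)
    = poly (map_poly of_real p) z * poly (map_poly of_real q) z"
  by (induction p) (simp_all add: map_poly_pCons map_poly_smult poly_of_real_poly_add algebra_simps)

text \<open>By the fundamental theorem of algebra \<open>f\<close> has a complex root. A real root
  splits off a linear factor, a nonreal one the product of the two conjugate linear factors.\<close>

lemma real_poly_factor:
  fixes f :: "real poly"
  assumes "degree f > 0"
  obtains (linear) a g where "f = [:- a, 1:] * g"
    | (quadratic) a b g where "b \<noteq> 0" "f = [:a\<^sup>2 + b\<^sup>2, - 2 * a, 1:] * g"
proof -
  let ?F = "map_poly complex_of_real f"
  have "degree ?F > 0" using assms by (simp add: degree_map_poly)
  then have "\<not> constant (poly ?F)" by (simp add: constant_degree)
  then obtain z where z: "poly ?F z = 0" using fundamental_theorem_of_algebra by blast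
  show thesis
  proof (cases "Im z = 0")
    case True
    then have "complex_of_real (poly f (Re z)) = poly ?F z"
      by (metis complex_is_Real_iff of_real_Re poly_of_real_poly)
    then have "[:- Re z, 1:] dvd f" using z by (simp add: poly_eq_0_iff_dvd)
    then show thesis using linear by (auto elim: dvdE)
  next
    case False
    \<comment> \<open>The real quadratic with root \<open>z\<close>. The remainder of
      \<open>f\<close> modulo \<open>q\<close> has degree below 2 and vanishes at the nonreal
      \<open>z\<close>, so both of its real coefficients are 0.\<close>
    define q where "q = [:(Re z)\<^sup>2 + (Im z)\<^sup>2, - 2 * Re z, 1:]"
    have q0: "q \<noteq> 0" "degree q = 2" by (simp_all add: q_def)
    define r where "r = f mod q"
    have deg: "degree r < 2 \<or> r = 0" using degree_mod_less[of q f] q0 by (auto simp: r_def)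
    then obtain c d where r: "r = [:c, d:]"
      by (metis (no_types, lifting) degree_pCons_eq_if less_2_cases_iff degree_eq_zeroE pCons_cases nat.inject numeral_2_eq_2 One_nat_def less_Suc0 pCons_0_0 Suc_less_eq)
    have "f = q * (f div q) + r" by (simp add: r_def)
    then have "poly ?F z = poly (map_poly complex_of_real q) z * poly (map_poly complex_of_real (f div q)) z
        + poly (map_poly complex_of_real r) z"
      by (metis poly_of_real_poly_add poly_of_real_poly_mult)
    moreover have "poly (map_poly complex_of_real q) z = 0"
      by (simp add: q_def map_poly_pCons complex_eq_iff power2_eq_square algebra_simps)
    ultimately have "poly (map_poly complex_of_real r) z = 0" using z by simp
    then have "complex_of_real c + z * complex_of_real d = 0" by (simp add: r map_poly_pCons)
    then have "c + Re z * d = 0" "Im z * d = 0" by (simp_all add: complex_eq_iff)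
    then have "r = 0" using False by (simp add: r)
    then have "q dvd f" by (simp add: r_def mod_eq_0_iff_dvd)
    then show thesis using quadratic[OF False] by (auto simp: q_def elim: dvdE)
  qed
qed

section \<open>Polynomials in a linear operator, applied to a vector\<close>

definition poly_op :: "('a::real_vector \<Rightarrow> 'a) \<Rightarrow> real poly \<Rightarrow> 'a \<Rightarrow> 'a" where
  "poly_op X p y = fold_coeffs (\<lambda>a v. a *\<^sub>R y + X v) p 0"

context
  fixes X :: "'a::real_vector \<Rightarrow> 'a"
  assumes X: "linear X"
begin

lemma poly_op_0 [simp]: "poly_op X 0 y = 0"
  by (simp add: poly_op_def)

lemma poly_op_pCons [simp]: "poly_op X (pCons a p) y = a *\<^sub>R y + X (poly_op X p y)"
  using linear_0[OF X] by (cases "p = 0 \<and> a = 0") (auto simp: poly_op_def)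

lemma poly_op_add: "poly_op X (p + q) y = poly_op X p y + poly_op X q y"
  by (induction p q rule: poly_induct2) (simp_all add: linear_add[OF X] algebra_simps)

lemma poly_op_smult: "poly_op X (smult c p) y = c *\<^sub>R poly_op X p y"
  by (induction p) (simp_all add: linear_scale[OF X] algebra_simps)

lemma poly_op_mult: "poly_op X (p * q) y = poly_op X p (poly_op X q y)"
  by (induction p) (simp_all add: poly_op_add poly_op_smult)

lemma poly_op_monom: "poly_op X (monom c i) y = c *\<^sub>R (X ^^ i) y"
  by (induction i) (simp_all add: monom_0 monom_Suc linear_scale[OF X] linear_0[OF X])

lemma poly_op_sum: "finite I \<Longrightarrow> poly_op X (\<Sum>i\<in>I. p i) y = (\<Sum>i\<in>I. poly_op X (p i) y)"
  by (induction I rule: finite_induct) (simp_all add: poly_op_add)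

lemma poly_op_in:
  assumes "subspace W" "X ` W \<subseteq> W" "y \<in> W"
  shows "poly_op X p y \<in> W"
  using assms by (induction p) (auto simp: subspace_0 linear_0[OF X] intro!: subspace_add subspace_scale)

text \<open>The iterates of \<open>y\<close> under \<open>X\<close> up to exponent
  \<open>card F\<close> are one too many to be independent in \<open>span F\<close>; a linear
  relation between them is the polynomial.\<close>

lemma annihilating_poly_exists:
  assumes W: "subspace W" "X ` W \<subseteq> W" "W \<subseteq> span F" "finite F" and y: "y \<in> W"
  shows "\<exists>f. f \<noteq> 0 \<and> poly_op X f y = 0"
proof (cases "inj_on (\<lambda>i. (X ^^ i) y) {..card F}")
  \<comment> \<open>Coinciding iterates form too small a set for the counting argument, but give the
    relation \<open>monom 1 i - monom 1 j\<close> at once.\<close>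
  case False
  then obtain i j where ij: "i \<noteq> j" "(X ^^ i) y = (X ^^ j) y" by (auto simp: inj_on_def)
  let ?f = "monom 1 i + monom (-1) j :: real poly"
  have "coeff ?f i \<noteq> 0" using ij by simp
  then have "?f \<noteq> 0" by force
  then show ?thesis using ij by (auto simp: poly_op_add poly_op_monom intro!: exI[of _ ?f])
next
  case True
  let ?P = "(\<lambda>i. (X ^^ i) y) ` {..card F}"
  have "(X ^^ i) y \<in> W" for i using W(2) y by (induction i) auto
  then have "?P \<subseteq> span F" using W(3) by auto
  moreover have "card ?P = Suc (card F)" using True by (simp add: card_image)
  ultimately have "dependent ?P" using independent_span_bound[OF W(4)] by fastforce
  then obtain u v where u: "(\<Sum>v\<in>?P. u v *\<^sub>R v) = 0" and v: "v \<in> ?P" "u v \<noteq> 0"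
    by (auto simp: dependent_finite)
  let ?f = "\<Sum>i\<le>card F. monom (u ((X ^^ i) y)) i"
  from v obtain i where i: "i \<le> card F" "u ((X ^^ i) y) \<noteq> 0" by auto
  then have "coeff ?f i \<noteq> 0" by (simp add: coeff_sum sum.delta)
  then have "?f \<noteq> 0" by force
  moreover have "poly_op X ?f y = 0"
    using u by (simp add: poly_op_sum poly_op_monom sum.reindex[OF True] o_def)
  ultimately show ?thesis by blast
qed

text \<open>Split a factor off a polynomial \<open>f\<close> annihilating \<open>y\<close>, with
  cofactor \<open>g\<close>. If \<open>g\<close> annihilates \<open>y\<close> as well, its degree is
  smaller and induction applies. Otherwise \<open>poly_op X g y\<close> is nonzero and killed by the
  factor: for a linear factor it is an eigenvector, and an irreducible quadratic factor contradicts
  positivity of \<open>B\<close>.\<close>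

lemma selfadjoint_eigenvector:
  fixes B :: "'a \<Rightarrow> 'a \<Rightarrow> real"
  assumes W: "subspace W" "X ` W \<subseteq> W" "W \<subseteq> span F" "finite F" and y: "y \<in> W" "y \<noteq> 0"
    and B: "bilinear B" "\<And>x. x \<in> W \<Longrightarrow> x \<noteq> 0 \<Longrightarrow> B x x > 0"
    and sa: "\<And>x y. x \<in> W \<Longrightarrow> y \<in> W \<Longrightarrow> B (X x) y = B x (X y)"
  obtains x l where "x \<in> W" "x \<noteq> 0" "X x = l *\<^sub>R x"
proof -
  have *: "\<exists>x\<in>W. x \<noteq> 0 \<and> (\<exists>l. X x = l *\<^sub>R x)" if "f \<noteq> 0" "poly_op X f y = 0" for f
    using that
  proof (induction "degree f" arbitrary: f rule: less_induct)
    case less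
    show ?case
    proof (cases "degree f = 0")
      case True
      then obtain a where "f = [:a:]" by (rule degree_eq_zeroE)
      then show ?thesis using less.prems y linear_0[OF X] by simp
    next
      case False
      then have "degree f > 0" by simp
      then show ?thesis
      proof (cases rule: real_poly_factor)
        case (linear a g)
        let ?u = "poly_op X g y"
        have "g \<noteq> 0" "degree g < degree f"
          using less.prems(1) unfolding linear by (auto simp del: mult_pCons_left simp: degree_mult_eq)
        then have "?u = 0 \<Longrightarrow> ?thesis" using less.hyps by blast
        moreover have "X ?u = a *\<^sub>R ?u"
          using less.prems(2) unfolding linear
          by (simp only: poly_op_mult) (simp add: linear_0[OF X])
        ultimately show ?thesis using poly_op_in[OF W(1,2) y(1), of g] by blast
      next
        case (quadratic a b g)
        let ?u = "poly_op X g y"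
        have "g \<noteq> 0" "degree g < degree f"
          using less.prems(1) unfolding quadratic by (auto simp del: mult_pCons_left simp: degree_mult_eq)
        then have "?u = 0 \<Longrightarrow> ?thesis" using less.hyps by blast
        moreover have "?u = 0"
        proof (rule ccontr)
          assume u: "?u \<noteq> 0"
          have uW: "?u \<in> W" by (rule poly_op_in[OF W(1,2) y(1)])
          then have XW: "X ?u \<in> W" "X (X ?u) \<in> W" using W(2) by auto
          \<comment> \<open>\<open>((X - a)\<^sup>2 + b\<^sup>2) u = 0\<close> means \<open>B w w = - b\<^sup>2 B u u\<close> for \<open>w = (X - a) u\<close>.\<close>
          let ?w = "X ?u - a *\<^sub>R ?u"
          have wW: "?w \<in> W" using W(1) XW uW by (intro subspace_diff subspace_scale)
          have 0: "(a\<^sup>2 + b\<^sup>2) *\<^sub>R ?u + X (- (2 * a) *\<^sub>R ?u + X ?u) = 0"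
            using less.prems(2) unfolding quadratic by (simp only: poly_op_mult) (simp add: linear_0[OF X])
          have 2: "(a * 2) *\<^sub>R X ?u = a *\<^sub>R X ?u + a *\<^sub>R X ?u"
            by (metis mult_2_right scaleR_add_left)
          have "X ?w - a *\<^sub>R ?w + (b\<^sup>2) *\<^sub>R ?u = (a\<^sup>2 + b\<^sup>2) *\<^sub>R ?u + X (- (2 * a) *\<^sub>R ?u + X ?u)"
            by (simp only: linear_diff[OF X] linear_scale[OF X] linear_add[OF X])
              (simp add: algebra_simps power2_eq_square 2)
          then have "X ?w - a *\<^sub>R ?w = - (b\<^sup>2) *\<^sub>R ?u" using 0 by (simp add: eq_neg_iff_add_eq_0)
          then have "B ?u (X ?w - a *\<^sub>R ?w) = - (b\<^sup>2) * B ?u ?u"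
            by (simp add: bilinear_rmul[OF B(1)] bilinear_rneg[OF B(1)])
          \<comment> \<open>\<open>X - a\<close> is self-adjoint on \<open>W\<close> and moves to
            the left argument.\<close>
          moreover have "B ?u (X ?w - a *\<^sub>R ?w) = B ?w ?w"
            using sa[OF uW wW] sa[OF uW uW]
            by (simp add: bilinear_rmul[OF B(1)] bilinear_lmul[OF B(1)] bilinear_rsub[OF B(1)] bilinear_lsub[OF B(1)] right_diff_distrib)
          moreover have "B ?w ?w \<ge> 0"
            using B(2)[OF wW] bilinear_lzero[OF B(1), of 0] by (metis less_eq_real_def)
          moreover have "b\<^sup>2 * B ?u ?u > 0" using quadratic B(2)[OF uW u] by simp
          ultimately show False by linarith
        qed
        ultimately show ?thesis by blast
      qed
    qed
  qed
  show thesis using annihilating_poly_exists[OF W y(1)] * that by blast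
qed

end

text \<open>Induction over the operators: the joint eigenspace \<open>U\<close> for the eigenvalues
  found so far is nonzero, and commutation makes it invariant under the next operator, which
  therefore has an eigenvector in it.\<close>

lemma commuting_selfadjoint_joint_eigenvector:
  fixes X :: "'k \<Rightarrow> 'a::real_vector \<Rightarrow> 'a" and B :: "'a \<Rightarrow> 'a \<Rightarrow> real"
  assumes X: "\<And>k. linear (X k)" "\<And>k. X k ` W \<subseteq> W"
    and W: "subspace W" "W \<subseteq> span F" "finite F" "W \<noteq> {0}"
    and B: "bilinear B" "\<And>x. x \<in> W \<Longrightarrow> x \<noteq> 0 \<Longrightarrow> B x x > 0"
    and sa: "\<And>k x y. x \<in> W \<Longrightarrow> y \<in> W \<Longrightarrow> B (X k x) y = B x (X k y)"
    and comm: "\<And>k l x. x \<in> W \<Longrightarrow> X k (X l x) = X l (X k x)"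
    and A: "finite A"
  shows "\<exists>x\<in>W. x \<noteq> 0 \<and> (\<exists>l. \<forall>k\<in>A. X k x = l k *\<^sub>R x)"
  using A
proof (induction A rule: finite_induct)
  case empty
  then show ?case using W(1,4) subspace_0 by auto
next
  case (insert m A)
  then obtain x l where x: "x \<in> W" "x \<noteq> 0" "\<forall>k\<in>A. X k x = l k *\<^sub>R x" by blast
  define U where "U = {x\<in>W. \<forall>k\<in>A. X k x = l k *\<^sub>R x}"
  have U: "subspace U"
    using W(1) by (auto simp: U_def subspace_def linear_add[OF X(1)] linear_scale[OF X(1)] linear_0[OF X(1)] algebra_simps)
  have inv: "X m ` U \<subseteq> U"
    using X(2) comm[of _ _ m] by (auto simp: U_def image_subset_iff linear_scale[OF X(1)])
  obtain z c where "z \<in> U" "z \<noteq> 0" "X m z = c *\<^sub>R z"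
    by (rule selfadjoint_eigenvector[OF X(1)[of m] U inv _ W(3) _ x(2) B(1), of])
      (use x W(2) B sa in \<open>auto simp: U_def\<close>)
  then show ?case using insert.hyps
    by (intro bexI[of _ z] conjI exI[of _ "l(m := c)"]) (auto simp: U_def)
qed

section \<open>Orthonormal sets of joint eigenvectors\<close>

lemma orthonormal_expansion:
  fixes B :: "'a::real_vector \<Rightarrow> 'a \<Rightarrow> real"
  assumes "bilinear B" "finite H" and on: "\<And>h h'. h \<in> H \<Longrightarrow> h' \<in> H \<Longrightarrow> B h h' = (if h = h' then 1 else 0)"
    and "h \<in> H"
  shows "B (\<Sum>h'\<in>H. u h' *\<^sub>R h') h = u h"
proof -
  have "linear (\<lambda>x. B x h)" using assms(1) by (simp add: bilinear_def)
  then have "B (\<Sum>h'\<in>H. u h' *\<^sub>R h') h = (\<Sum>h'\<in>H. u h' * B h' h)"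
    by (simp add: linear_sum[of "\<lambda>x. B x h"] linear_scale[of "\<lambda>x. B x h"])
  also have "\<dots> = (\<Sum>h'\<in>H. if h' = h then u h' else 0)"
    using on \<open>h \<in> H\<close> by (intro sum.cong) auto
  finally show ?thesis using assms by simp
qed

lemma orthonormal_independent:
  fixes B :: "'a::real_vector \<Rightarrow> 'a \<Rightarrow> real"
  assumes "bilinear B" "finite H" "\<And>h h'. h \<in> H \<Longrightarrow> h' \<in> H \<Longrightarrow> B h h' = (if h = h' then 1 else 0)"
  shows "independent H"
proof
  assume "dependent H"
  then obtain u v where "(\<Sum>v\<in>H. u v *\<^sub>R v) = 0" "v \<in> H" "u v \<noteq> 0"
    using assms(2) by (auto simp: dependent_finite)
  then show False using orthonormal_expansion[OF assms \<open>v \<in> H\<close>, where u = u] bilinear_lzero[OF assms(1)] by simp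
qed

text \<open>An orthonormal set of joint eigenvectors of maximal size is a basis, since otherwise its
  orthogonal complement in \<open>S\<close> would contain a further joint eigenvector.\<close>

lemma commuting_selfadjoint_joint_eigenbasis:
  fixes X :: "'k::finite \<Rightarrow> 'a::real_vector \<Rightarrow> 'a" and B :: "'a \<Rightarrow> 'a \<Rightarrow> real"
  assumes X: "\<And>k. linear (X k)" "\<And>k. X k ` S \<subseteq> S"
    and S: "subspace S" "S \<subseteq> span F" "finite F"
    and B: "bilinear B" "\<And>x y. B x y = B y x" "\<And>x. x \<in> S \<Longrightarrow> x \<noteq> 0 \<Longrightarrow> B x x > 0"
    and sa: "\<And>k x y. x \<in> S \<Longrightarrow> y \<in> S \<Longrightarrow> B (X k x) y = B x (X k y)"
    and comm: "\<And>k l x. x \<in> S \<Longrightarrow> X k (X l x) = X l (X k x)"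
  obtains H l where "finite H" "H \<subseteq> S"
    "\<And>h h'. h \<in> H \<Longrightarrow> h' \<in> H \<Longrightarrow> B h h' = (if h = h' then 1 else 0)"
    "\<And>h k. h \<in> H \<Longrightarrow> X k h = l h k *\<^sub>R h"
    "\<And>x. x \<in> S \<Longrightarrow> x = (\<Sum>h\<in>H. B x h *\<^sub>R h)"
proof -
  define P where "P H \<longleftrightarrow> finite H \<and> H \<subseteq> S \<and> (\<forall>h\<in>H. \<forall>h'\<in>H. B h h' = (if h = h' then 1 else 0))
    \<and> (\<forall>h\<in>H. \<exists>l. \<forall>k. X k h = l k *\<^sub>R h)" for H
  have "P {}" by (simp add: P_def)
  \<comment> \<open>Orthonormal sets are independent, so their size is bounded and a largest one
    exists.\<close>
  moreover have "card H \<le> card F" if "P H" for H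
    using that independent_span_bound[OF S(3) orthonormal_independent[OF B(1), of H]] S(2)
    by (auto simp: P_def)
  ultimately obtain H where H: "P H" and max: "\<And>H'. P H' \<Longrightarrow> card H' \<le> card H"
    using ex_has_greatest_nat[of P "{}" card "Suc (card F)"] by (metis less_Suc_eq_le)
  then have fin: "finite H" and HS: "H \<subseteq> S"
    and on: "\<And>h h'. h \<in> H \<Longrightarrow> h' \<in> H \<Longrightarrow> B h h' = (if h = h' then 1 else 0)"
    and ev: "\<forall>h\<in>H. \<exists>l. \<forall>k. X k h = l k *\<^sub>R h" by (auto simp: P_def)
  from ev obtain l where l: "\<And>h k. h \<in> H \<Longrightarrow> X k h = l h k *\<^sub>R h" by metis
  note Bl = bilinear_ladd[OF B(1)] bilinear_lsub[OF B(1)] bilinear_lmul[OF B(1)] bilinear_lzero[OF B(1)]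
    bilinear_radd[OF B(1)] bilinear_rsub[OF B(1)] bilinear_rmul[OF B(1)] bilinear_rzero[OF B(1)]
  \<comment> \<open>The orthogonal complement of \<open>H\<close> in \<open>S\<close>. It is
    invariant because the members of \<open>H\<close> are eigenvectors of self-adjoint
    operators.\<close>
  define U where "U = {x\<in>S. \<forall>h\<in>H. B x h = 0}"
  have U: "subspace U" using S(1) by (auto simp: U_def subspace_def Bl)
  have "U = {0}"
  proof (rule ccontr)
    assume "U \<noteq> {0}"
    have inv: "X k ` U \<subseteq> U" for k
    proof safe
      fix x assume x: "x \<in> U"
      have "B (X k x) h = 0" if "h \<in> H" for h
      proof -
        have "B (X k x) h = B x (X k h)" using sa x that HS by (auto simp: U_def)
        then show ?thesis using l[OF that] x that by (simp add: Bl U_def)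
      qed
      then show "X k x \<in> U" using X(2) x by (auto simp: U_def)
    qed
    have "\<exists>x\<in>U. x \<noteq> 0 \<and> (\<exists>l. \<forall>k\<in>UNIV. X k x = l k *\<^sub>R x)"
      by (rule commuting_selfadjoint_joint_eigenvector[where B = B and F = F])
        (use X(1) inv U S B \<open>U \<noteq> {0}\<close> sa comm in \<open>auto simp: U_def\<close>)
    then obtain x m where x: "x \<in> U" "x \<noteq> 0" "\<And>k. X k x = m k *\<^sub>R x" by auto
    \<comment> \<open>The normalised \<open>x\<close> enlarges \<open>H\<close>, against its
      maximality.\<close>
    define e where "e = (1 / sqrt (B x x)) *\<^sub>R x"
    have pos: "B x x > 0" using x B(3) by (auto simp: U_def)
    have eU: "e \<in> U" using x U by (auto simp: e_def intro: subspace_scale)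
    have ee: "B e e = 1" using pos by (simp add: e_def Bl field_simps)
    have "e \<notin> H" using eU ee on[of e e] by (auto simp: U_def)
    moreover have "P (insert e H)"
    proof -
      have "\<forall>k. X k e = m k *\<^sub>R e" using x(3) by (simp add: e_def linear_scale[OF X(1)])
      moreover have "B e h = 0" "B h e = 0" if "h \<in> H" for h
        using that eU B(2)[of h e] by (auto simp: U_def)
      ultimately show ?thesis using H eU ee \<open>e \<notin> H\<close> unfolding P_def by (auto simp: U_def)
    qed
    ultimately show False using max[of "insert e H"] fin by simp
  qed
  \<comment> \<open>The difference of \<open>x\<close> and its Fourier sum is orthogonal to
    \<open>H\<close>, hence lies in \<open>U\<close>.\<close>
  have "x = (\<Sum>h\<in>H. B x h *\<^sub>R h)" if x: "x \<in> S" for x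
  proof -
    have "x - (\<Sum>h\<in>H. B x h *\<^sub>R h) \<in> U"
      unfolding U_def using x HS S(1) orthonormal_expansion[OF B(1) fin on]
      by (auto simp: Bl intro!: subspace_diff subspace_sum subspace_scale)
    then show ?thesis using \<open>U = {0}\<close> by simp
  qed
  then show thesis using that fin HS on l by blast
qed

section \<open>Polynomials as linear combinations of monomials\<close>

text \<open>The linear functional with value \<open>f i\<close> on the monomial of index
  \<open>i\<close>: the Riesz functional if \<open>f\<close> is a moment sequence, evaluation at
  \<open>t\<close> if \<open>f i\<close> is \<open>monomial i t\<close>.\<close>

definition coeff_pairing :: "('i \<Rightarrow> real) \<Rightarrow> ('i \<Rightarrow>\<^sub>0 real) \<Rightarrow> real" where
  "coeff_pairing f p = (\<Sum>i\<in>Poly_Mapping.keys p. Poly_Mapping.lookup p i * f i)"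

lemma lookup_scaleR [simp]: "Poly_Mapping.lookup (c *\<^sub>R p) i = c *\<^sub>R Poly_Mapping.lookup p i"
proof -
  have "finite {i. c *\<^sub>R Poly_Mapping.lookup p i \<noteq> 0}"
    by (rule finite_subset[OF _ finite_keys[of p]]) (auto simp: in_keys_iff)
  then show ?thesis by (simp add: scaleR_poly_mapping_def)
qed

lemma coeff_pairing_superset:
  assumes "finite A" "Poly_Mapping.keys p \<subseteq> A"
  shows "coeff_pairing f p = (\<Sum>i\<in>A. Poly_Mapping.lookup p i * f i)"
  unfolding coeff_pairing_def using assms by (intro sum.mono_neutral_left) (auto simp: in_keys_iff)

lemma linear_coeff_pairing: "linear (coeff_pairing f)"
proof (rule linearI)
  fix p q :: "'a \<Rightarrow>\<^sub>0 real" and c :: real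
  let ?A = "Poly_Mapping.keys p \<union> Poly_Mapping.keys q"
  show "coeff_pairing f (p + q) = coeff_pairing f p + coeff_pairing f q"
    using keys_add[of p q]
    by (simp add: coeff_pairing_superset[of ?A] lookup_add sum.distrib algebra_simps)
  show "coeff_pairing f (c *\<^sub>R p) = c *\<^sub>R coeff_pairing f p"
    by (subst (1 2) coeff_pairing_superset[of "Poly_Mapping.keys p"])
      (auto simp: in_keys_iff sum_distrib_left mult_ac)
qed

lemma coeff_pairing_single [simp]: "coeff_pairing f (Poly_Mapping.single i c) = c * f i"
  by (simp add: coeff_pairing_def)

lemma poly_mapping_expansion:
  fixes p :: "'i \<Rightarrow>\<^sub>0 real"
  shows "p = (\<Sum>i\<in>Poly_Mapping.keys p. Poly_Mapping.lookup p i *\<^sub>R Poly_Mapping.single i 1)"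
proof (rule poly_mapping_eqI)
  fix k
  have "Poly_Mapping.lookup (\<Sum>i\<in>Poly_Mapping.keys p. Poly_Mapping.lookup p i *\<^sub>R Poly_Mapping.single i (1::real)) k
    = (\<Sum>i\<in>Poly_Mapping.keys p. if i = k then Poly_Mapping.lookup p i else 0)"
    unfolding lookup_sum by (intro sum.cong) (auto simp: lookup_single when_def)
  also have "\<dots> = Poly_Mapping.lookup p k" by (simp add: sum.delta in_keys_iff)
  finally show "Poly_Mapping.lookup p k = Poly_Mapping.lookup (\<Sum>i\<in>Poly_Mapping.keys p. Poly_Mapping.lookup p i *\<^sub>R Poly_Mapping.single i (1::real)) k"
    by simp
qed

text \<open>The standard device below: identities for products of polynomials are linear in each
  factor, so one factor at a time is reduced to a monomial.\<close>

lemma linear_eq_on_monomials: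
  fixes f g :: "('i \<Rightarrow>\<^sub>0 real) \<Rightarrow> 'b::real_vector"
  assumes "linear f" "linear g"
    and "\<And>i. i \<in> Poly_Mapping.keys p \<Longrightarrow> f (Poly_Mapping.single i 1) = g (Poly_Mapping.single i 1)"
  shows "f p = g p"
  using assms(3) by (subst (1 2) poly_mapping_expansion)
    (simp add: linear_sum[OF assms(1)] linear_sum[OF assms(2)] linear_scale[OF assms(1)] linear_scale[OF assms(2)])

text \<open>Scalars become constant polynomials, which makes bilinearity of multiplication a matter
  of ring identities.\<close>

lemma scaleR_conv_mult_single: "c *\<^sub>R p = Poly_Mapping.single 0 c * (p :: 'i::monoid_add \<Rightarrow>\<^sub>0 real)"
  by (rule poly_mapping_eqI) (simp add: mult_map_scale_conv_mult[symmetric] Poly_Mapping.map.rep_eq when_def)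

lemma bilinear_poly_mult: "bilinear ((*) :: ('i::comm_monoid_add \<Rightarrow>\<^sub>0 real) \<Rightarrow> _ \<Rightarrow> _)"
  unfolding bilinear_def
  by (auto intro!: linearI simp: scaleR_conv_mult_single algebra_simps)

lemmas poly_mult_linear_left = bilinear_poly_mult[unfolded bilinear_def, THEN conjunct1, rule_format]
lemmas poly_mult_linear_right = bilinear_poly_mult[unfolded bilinear_def, THEN conjunct2, rule_format]

section \<open>Multi-indices and monomials\<close>

lemma mdeg_add: "mdeg (i + j) = mdeg i + mdeg j"
  by (simp add: mdeg_def sum.distrib)

lemma mdeg_axis [simp]: "mdeg (axis k m) = m"
  by (simp add: mdeg_def axis_def)

lemma mdeg_zero [simp]: "mdeg 0 = 0"
  by (simp add: mdeg_def)

lemma mdeg_Suc_split: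
  fixes i :: "nat ^ 'n"
  assumes "mdeg i = Suc m"
  obtains k j where "i = axis k 1 + j" "mdeg j = m"
proof -
  have "\<exists>k. i $ k \<noteq> 0" using assms by (metis mdeg_def sum.neutral nat.distinct(1))
  then obtain k where "i $ k \<noteq> 0" by blast
  define j where "j = (\<chi> l. if l = k then i $ l - 1 else i $ l)"
  have i: "i = axis k 1 + j"
    using \<open>i $ k \<noteq> 0\<close> by (auto simp: vec_eq_iff axis_def j_def)
  then have "mdeg j = m"
    using assms by (simp add: mdeg_add)
  with i that show thesis by blast
qed

lemma mdeg_zero_iff [simp]: "mdeg i = 0 \<longleftrightarrow> i = 0"
  by (simp add: mdeg_def vec_eq_iff)

text \<open>Serves to write a monomial of degree at most \<open>2 * Suc n\<close> as a product of
  two of degree at most \<open>Suc n\<close>, the form in which the quadrature formula applies. The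
  first factor collects one variable at a time.\<close>

lemma mdeg_le_add_split:
  fixes i :: "nat ^ 'n"
  assumes "mdeg i \<le> a + b"
  obtains j l where "i = j + l" "mdeg j \<le> a" "mdeg l \<le> b"
proof -
  have "\<exists>j l. i = j + l \<and> mdeg j \<le> a \<and> mdeg l \<le> b"
    using assms
  proof (induction a arbitrary: i)
    case 0
    then show ?case by (intro exI[of _ 0] exI[of _ i]) simp
  next
    case (Suc a)
    show ?case
    proof (cases "mdeg i")
      case 0
      then show ?thesis by (intro exI[of _ 0]) simp
    next
      case (Suc m)
      then obtain k i' where i: "i = axis k 1 + i'" "mdeg i' = m" by (rule mdeg_Suc_split)
      then obtain j l where "i' = j + l" "mdeg j \<le> a" "mdeg l \<le> b"
        using Suc.IH[of i'] Suc Suc.prems by auto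
      then show ?thesis using i
        by (intro exI[of _ "axis k 1 + j"] exI[of _ l]) (simp add: mdeg_add add.assoc)
    qed
  qed
  then show thesis using that by blast
qed

lemma monomial_add: "monomial (i + j) t = monomial i t * monomial j t"
  by (simp add: monomial_def power_add prod.distrib)

lemma monomial_axis [simp]: "monomial (axis k 1) t = t $ k"
proof -
  have "monomial (axis k 1) t = (\<Prod>l\<in>UNIV. if l = k then t $ l else 1)"
    unfolding monomial_def by (intro prod.cong) (auto simp: axis_def)
  then show ?thesis by simp
qed

lemma monomial_zero [simp]: "monomial 0 t = 1"
  by (simp add: monomial_def)

lemma borel_measurable_monomial [measurable]: "monomial i \<in> borel_measurable borel"
  unfolding monomial_def[abs_def] by measurable

lemma eval_poly_conv_pairing: "eval_poly p t = coeff_pairing (\<lambda>i. monomial i t) p"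
  by (simp add: eval_poly_def coeff_pairing_def)

lemma linear_eval_poly: "linear (\<lambda>p. eval_poly p t)"
  using linear_coeff_pairing by (simp add: eval_poly_conv_pairing[abs_def])

lemma eval_poly_single [simp]: "eval_poly (Poly_Mapping.single i c) t = c * monomial i t"
  by (simp add: eval_poly_conv_pairing)

lemma eval_poly_one [simp]: "eval_poly 1 t = 1"
  using eval_poly_single[of 0 1 t] by simp

lemma eval_poly_mult: "eval_poly (p * q) t = eval_poly p t * eval_poly q t"
proof -
  have 1: "eval_poly (Poly_Mapping.single i 1 * q) t = monomial i t * eval_poly q t" for i
    by (rule linear_eq_on_monomials[of _ _ q])
      (auto simp: mult_single monomial_add
        intro!: linear_compose[OF poly_mult_linear_left linear_eval_poly, unfolded o_def]
          linear_compose[OF linear_eval_poly linear_times, unfolded o_def])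
  show ?thesis
    by (rule linear_eq_on_monomials[of _ _ p])
      (auto simp: 1 intro!: linear_compose[OF poly_mult_linear_right linear_eval_poly, unfolded o_def]
        linear_compose[OF linear_eval_poly, unfolded o_def] bounded_linear.linear[OF bounded_linear_mult_left])
qed

section \<open>Polynomials of bounded degree\<close>

lemma deg_le_single: "mdeg i \<le> m \<Longrightarrow> deg_le (Poly_Mapping.single i c) m"
  by (simp add: deg_le_def)

lemma deg_le_one [simp]: "deg_le 1 m"
  using deg_le_single[of 0 m 1] by simp

lemma deg_le_mult:
  assumes "deg_le p a" "deg_le q b"
  shows "deg_le (p * q) (a + b)"
  unfolding deg_le_def
proof
  fix i assume "i \<in> Poly_Mapping.keys (p * q)"
  then obtain j l where "i = j + l" "j \<in> Poly_Mapping.keys p" "l \<in> Poly_Mapping.keys q"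
    using keys_mult[of p q] by blast
  then show "mdeg i \<le> a + b" using assms by (auto simp: deg_le_def mdeg_add intro: add_mono)
qed

lemma deg_le_mono: "deg_le p a \<Longrightarrow> a \<le> b \<Longrightarrow> deg_le p b"
  by (auto simp: deg_le_def)

lemma deg_le_eq_span:
  "{p :: ('n::finite) mpoly_real. deg_le p m} = span ((\<lambda>i. Poly_Mapping.single i 1) ` multi_indices m)"
    (is "?L = span ?S")
proof
  show "?L \<subseteq> span ?S"
  proof safe
    fix p :: "'n mpoly_real" assume "deg_le p m"
    then have "(\<Sum>i\<in>Poly_Mapping.keys p. Poly_Mapping.lookup p i *\<^sub>R Poly_Mapping.single i 1) \<in> span ?S"
      by (intro span_sum span_scale span_base) (auto simp: deg_le_def multi_indices_def)
    then show "p \<in> span ?S" by (metis poly_mapping_expansion)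
  qed
  have "subspace ?L"
    by (auto simp: subspace_def deg_le_def in_keys_iff lookup_add)
  then show "span ?S \<subseteq> ?L"
    by (intro span_minimal) (auto simp: deg_le_single multi_indices_def)
qed

lemma subspace_deg_le: "subspace {p :: ('n::finite) mpoly_real. deg_le p m}"
  by (simp add: deg_le_eq_span)

lemma deg_le_add: "deg_le p m \<Longrightarrow> deg_le q m \<Longrightarrow> deg_le (p + q :: ('n::finite) mpoly_real) m"
  using subspace_add[OF subspace_deg_le] by blast

lemma deg_le_diff: "deg_le p m \<Longrightarrow> deg_le q m \<Longrightarrow> deg_le (p - q :: ('n::finite) mpoly_real) m"
  using subspace_diff[OF subspace_deg_le] by blast

lemma deg_le_scale: "deg_le p m \<Longrightarrow> deg_le (c *\<^sub>R p :: ('n::finite) mpoly_real) m"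
  using subspace_scale[OF subspace_deg_le] by blast

lemma deg_le_sum: "(\<And>i. i \<in> I \<Longrightarrow> deg_le (p i) m) \<Longrightarrow> deg_le (\<Sum>i\<in>I. p i :: ('n::finite) mpoly_real) m"
  using subspace_sum[OF subspace_deg_le, of I p m] by blast

section \<open>Columns of the moment matrix as images of polynomials\<close>

lemma linear_column_comb: "linear (column_comb n \<beta>)"
proof (rule linearI)
  fix p q :: "'a mpoly_real" and c :: real
  have *: "column_comb n \<beta> p = (\<Sum>i\<in>A. Poly_Mapping.lookup p i *\<^sub>R moment_column n \<beta> i)"
    if "finite A" "Poly_Mapping.keys p \<subseteq> A" for p A
    unfolding column_comb_def using that by (intro sum.mono_neutral_left) (auto simp: in_keys_iff)
  let ?A = "Poly_Mapping.keys p \<union> Poly_Mapping.keys q"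
  show "column_comb n \<beta> (p + q) = column_comb n \<beta> p + column_comb n \<beta> q"
    using keys_add[of p q] by (simp add: *[of ?A] lookup_add sum.distrib scaleR_add_left)
  show "column_comb n \<beta> (c *\<^sub>R p) = c *\<^sub>R column_comb n \<beta> p"
    by (subst (1 2) *[of "Poly_Mapping.keys p"]) (auto simp: in_keys_iff scaleR_sum_right)
qed

lemma column_comb_single [simp]: "column_comb n \<beta> (Poly_Mapping.single j 1) = moment_column n \<beta> j"
  by (simp add: column_comb_def)

lemma span_moment_columns: "span (moment_columns n \<beta>) = column_comb n \<beta> ` {p. deg_le p n}"
  by (simp add: deg_le_eq_span moment_columns_def image_image flip: span_linear_image[OF linear_column_comb])

lemma coeff_pairing_single_mult:
  "coeff_pairing f (Poly_Mapping.single i 1 * p) = coeff_pairing (\<lambda>j. f (i + j :: 'i::comm_monoid_add)) p"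
  by (rule linear_eq_on_monomials[of _ _ p])
    (auto simp: mult_single intro: linear_coeff_pairing
       linear_compose[OF poly_mult_linear_left linear_coeff_pairing, unfolded o_def])

lemma lookup_column_comb:
  "Poly_Mapping.lookup (column_comb n \<beta> p) i
    = (if i \<in> multi_indices n then coeff_pairing \<beta> (Poly_Mapping.single i 1 * p) else 0)"
  by (simp add: coeff_pairing_single_mult)
    (simp add: column_comb_def lookup_sum moment_column.rep_eq coeff_pairing_def moment_matrix_def)

text \<open>Row \<open>i\<close> of the column is the pairing of \<open>p\<close> with the monomial
  of index \<open>i\<close>, and monomials of degree at most \<open>n\<close> span the test
  polynomials. Kernel vectors thus become polynomials orthogonal to all of these.\<close>

lemma column_comb_eq_0_iff:
  "column_comb n \<beta> p = 0 \<longleftrightarrow> (\<forall>q. deg_le q n \<longrightarrow> coeff_pairing \<beta> (q * p) = 0)"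
proof
  assume 0: "column_comb n \<beta> p = 0"
  have "coeff_pairing \<beta> (q * p) = (0::real)" if "deg_le q n" for q
  proof (rule linear_eq_on_monomials[of "\<lambda>q. coeff_pairing \<beta> (q * p)" "\<lambda>q. 0" q])
    show "linear (\<lambda>q. coeff_pairing \<beta> (q * p))"
      by (rule linear_compose[OF poly_mult_linear_right linear_coeff_pairing, unfolded o_def])
    fix i assume "i \<in> Poly_Mapping.keys q"
    then have "i \<in> multi_indices n" using that by (auto simp: deg_le_def multi_indices_def)
    then show "coeff_pairing \<beta> (Poly_Mapping.single i 1 * p) = 0"
      using lookup_column_comb[of n \<beta> p i] 0 by simp
  qed (simp add: module_hom_zero)
  then show "\<forall>q. deg_le q n \<longrightarrow> coeff_pairing \<beta> (q * p) = 0" by blast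
next
  assume "\<forall>q. deg_le q n \<longrightarrow> coeff_pairing \<beta> (q * p) = 0"
  then show "column_comb n \<beta> p = 0"
    by (intro poly_mapping_eqI) (simp add: lookup_column_comb deg_le_single multi_indices_def)
qed

section \<open>Flat extensions\<close>

lemma linear_independent_imageD:
  assumes f: "linear f" "inj_on f D" and ind: "independent (f ` D)"
  shows "independent D"
proof
  assume "dependent D"
  then obtain a where a: "a \<in> D" "a \<in> span (D - {a})" by (auto simp: dependent_def)
  then have "f a \<in> span (f ` (D - {a}))" by (simp add: linear_span_image[OF f(1)])
  moreover have "f ` (D - {a}) = f ` D - {f a}" using f(2) a(1) by (auto simp: inj_on_def)
  ultimately show False using ind a(1) by (auto simp: dependent_def)
qed

text \<open>\<open>b\<close> is the extended sequence. Positivity is given for \<open>M(n)\<close>;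
  for \<open>M(n+1)\<close> it is derived from flatness in \<open>L_square_nonneg\<close>.\<close>

locale flat_moments =
  fixes n :: nat and b :: "nat ^ 'n \<Rightarrow> real"
  assumes psd: "psd_on (multi_indices n) (moment_matrix b)"
    and flat: "moment_rank (Suc n) b = moment_rank n b"
begin

lemma multi_indices_SucI: "i \<in> multi_indices n \<Longrightarrow> i \<in> multi_indices (Suc n)"
  by (simp add: multi_indices_def)

abbreviation L :: "'n mpoly_real \<Rightarrow> real" where
  "L \<equiv> coeff_pairing b"

abbreviation M :: "'n mpoly_real \<Rightarrow> (nat ^ 'n) \<Rightarrow>\<^sub>0 real" where
  "M \<equiv> column_comb (Suc n) b"

abbreviation var :: "'n \<Rightarrow> 'n mpoly_real" where
  "var k \<equiv> Poly_Mapping.single (axis k 1) 1"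

lemmas L_simps = linear_add[OF linear_coeff_pairing] linear_diff[OF linear_coeff_pairing]
  linear_scale[OF linear_coeff_pairing] linear_0[OF linear_coeff_pairing]

lemmas M_simps = linear_add[OF linear_column_comb] linear_diff[OF linear_column_comb]
  linear_scale[OF linear_column_comb] linear_0[OF linear_column_comb]

lemma M_eq_0D: "M p = 0 \<Longrightarrow> deg_le q (Suc n) \<Longrightarrow> L (q * p) = 0"
  by (simp add: column_comb_eq_0_iff)

text \<open>Deletes the rows of degree above \<open>n\<close>, so that columns of
  \<open>M(n+1)\<close> can be compared with those of \<open>M(n)\<close>.\<close>

definition trunc :: "((nat ^ 'n) \<Rightarrow>\<^sub>0 real) \<Rightarrow> (nat ^ 'n) \<Rightarrow>\<^sub>0 real" where
  "trunc f = (\<Sum>i\<in>multi_indices n. Poly_Mapping.lookup f i *\<^sub>R Poly_Mapping.single i 1)"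

lemma linear_trunc: "linear trunc"
  by (rule linearI) (simp_all add: trunc_def lookup_add sum.distrib scaleR_add_left scaleR_sum_right)

lemma trunc_M: "trunc (M p) = column_comb n b p"
proof (rule poly_mapping_eqI)
  fix i
  have "Poly_Mapping.lookup (trunc (M p)) i
      = (\<Sum>j\<in>multi_indices n. if j = i then Poly_Mapping.lookup (M p) j else 0)"
    unfolding trunc_def lookup_sum by (intro sum.cong) (auto simp: lookup_single when_def)
  also have "\<dots> = Poly_Mapping.lookup (column_comb n b p) i"
    by (simp add: sum.delta[OF finite_multi_indices] lookup_column_comb multi_indices_SucI)
  finally show "Poly_Mapping.lookup (trunc (M p)) i = Poly_Mapping.lookup (column_comb n b p) i" .
qed

text \<open>Take indices \<open>J\<close> whose columns form a basis of the column space of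
  \<open>M(n)\<close>. The longer columns of \<open>M(n+1)\<close> with these indices are
  independent because their truncations are, and by flatness there are enough of them to span. Since
  \<open>trunc\<close> carries this basis injectively to an independent set, it is injective on the
  span.\<close>

lemma flat_columns:
  obtains J where "J \<subseteq> multi_indices n"
    "moment_columns (Suc n) b \<subseteq> span (moment_column (Suc n) b ` J)"
    "inj_on trunc (span (moment_column (Suc n) b ` J))"
proof -
  obtain C where C: "C \<subseteq> moment_columns n b" "independent C" "moment_columns n b \<subseteq> span C"
    "card C = dim (moment_columns n b)"
    by (rule basis_exists)
  then obtain J where J: "J \<subseteq> multi_indices n" "inj_on (moment_column n b) J" "C = moment_column n b ` J"
    unfolding moment_columns_def by (metis subset_image_inj)
  define D where "D = moment_column (Suc n) b ` J"
  have tr: "trunc (moment_column (Suc n) b j) = moment_column n b j" for j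
    using trunc_M[of "Poly_Mapping.single j 1"] by simp
  have img: "trunc ` D = C" by (simp add: D_def J(3) image_image tr)
  have inj: "inj_on trunc D"
    using J(2) by (auto simp: D_def inj_on_def tr)
  have "inj_on (moment_column (Suc n) b) J"
    using J(2) tr by (metis inj_on_def)
  then have cardD: "card D = moment_rank n b"
    using C(4) J by (simp add: D_def card_image moment_rank_def)
  have indD: "independent D"
    using linear_trunc inj C(2) img by (metis linear_independent_imageD)
  obtain C' where C': "C' \<subseteq> moment_columns (Suc n) b" "independent C'"
    "moment_columns (Suc n) b \<subseteq> span C'" "card C' = dim (moment_columns (Suc n) b)"
    by (rule basis_exists)
  have "finite (moment_columns (Suc n) b)"
    by (simp add: moment_columns_def finite_multi_indices)
  then have finC': "finite C'" using C'(1) finite_subset by blast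
  have Dsub: "D \<subseteq> moment_columns (Suc n) b"
    using J(1) by (auto simp: D_def moment_columns_def multi_indices_def)
  \<comment> \<open>A column outside the span would enlarge \<open>D\<close> to an independent set
    with more elements than the rank of \<open>M(n+1)\<close>.\<close>
  have "moment_columns (Suc n) b \<subseteq> span D"
  proof (rule ccontr)
    assume "\<not> moment_columns (Suc n) b \<subseteq> span D"
    then obtain c where c: "c \<in> moment_columns (Suc n) b" "c \<notin> span D" by blast
    have "independent (insert c D)" using indD c(2) by (rule independent_insertI[rotated])
    moreover have "insert c D \<subseteq> span C'" using c(1) Dsub C'(3) by blast
    ultimately have le: "finite (insert c D) \<and> card (insert c D) \<le> card C'"
      by (rule independent_span_bound[OF finC'])
    have "c \<notin> D" using c(2) span_base by blast
    then have "card (insert c D) = Suc (card D)" using le by simp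
    then show False using le cardD C'(4) flat by (simp add: moment_rank_def)
  qed
  moreover have "inj_on trunc (span D)"
    using linear_inj_on_span_independent_image[OF linear_trunc] C(2) img inj by metis
  ultimately show thesis using J(1) that by (simp add: D_def)
qed

lemma flat_reduce:
  assumes "deg_le p (Suc n)"
  obtains q where "deg_le q n" "M q = M p"
proof -
  obtain J where J: "J \<subseteq> multi_indices n" "moment_columns (Suc n) b \<subseteq> span (moment_column (Suc n) b ` J)"
    by (rule flat_columns)
  have "M p \<in> span (moment_columns (Suc n) b)"
    using assms by (auto simp: span_moment_columns)
  also have "\<dots> \<subseteq> span (moment_column (Suc n) b ` J)"
    using J(2) by (simp add: span_minimal)
  also have "\<dots> \<subseteq> span (M ` (\<lambda>i. Poly_Mapping.single i 1) ` multi_indices n)"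
    using J(1) by (intro span_mono) (simp add: image_image image_mono)
  also have "\<dots> = M ` {q. deg_le q n}"
    by (simp only: deg_le_eq_span linear_span_image[OF linear_column_comb])
  finally show thesis using that by force
qed

text \<open>The hypothesis says that the rows of degree at most \<open>n\<close> of
  \<open>M p\<close> vanish, and deleting the other rows is injective on the column space.\<close>

lemma flat_kernel:
  assumes "deg_le p (Suc n)" "\<And>q. deg_le q n \<Longrightarrow> L (q * p) = 0"
  shows "M p = 0"
proof -
  obtain J where J: "moment_columns (Suc n) b \<subseteq> span (moment_column (Suc n) b ` J)"
    "inj_on trunc (span (moment_column (Suc n) b ` J))"
    by (rule flat_columns)
  have "M p \<in> span (moment_columns (Suc n) b)"
    using assms by (auto simp: span_moment_columns)
  then have "M p \<in> span (moment_column (Suc n) b ` J)"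
    using J(1) span_minimal subspace_span by blast
  moreover have "trunc (M p) = trunc 0"
    using assms(2) by (simp add: trunc_M column_comb_eq_0_iff linear_0[OF linear_trunc])
  ultimately show ?thesis using J(2) span_0 by (metis inj_onD)
qed

section \<open>The kernel of the form and its positivity\<close>

lemma deg_le_var_mult: "deg_le p m \<Longrightarrow> deg_le (var k * p) (Suc m)"
  using deg_le_mult[of "var k" 1 p m] by (simp add: deg_le_single add.commute)

text \<open>Against a test polynomial of degree at most \<open>n\<close> the variable moves from
  \<open>p\<close> to the test polynomial, whose degree stays at most \<open>n + 1\<close>; by
  \<open>flat_kernel\<close> such tests suffice.\<close>

lemma flat_kernel_ideal:
  assumes "deg_le p n" "M p = 0"
  shows "M (var k * p) = 0"
proof (rule flat_kernel)
  show "deg_le (var k * p) (Suc n)" by (rule deg_le_var_mult[OF assms(1)])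
  fix q :: "'n mpoly_real" assume "deg_le q n"
  then have "L ((var k * q) * p) = 0" by (intro M_eq_0D assms(2) deg_le_var_mult)
  then show "L (q * (var k * p)) = 0" by (simp add: mult_ac)
qed

lemma L_square_nonneg_n:
  assumes "deg_le p n"
  shows "L (p * p) \<ge> 0"
proof -
  let ?l = "Poly_Mapping.lookup p"
  have keys: "Poly_Mapping.keys p \<subseteq> multi_indices n"
    using assms by (auto simp: deg_le_def multi_indices_def)
  have 1: "L (Poly_Mapping.single i 1 * p) = (\<Sum>j\<in>multi_indices n. ?l j * b (i + j))" for i
    unfolding coeff_pairing_single_mult by (rule coeff_pairing_superset[OF finite_multi_indices keys])
  have "L (p * p) = coeff_pairing (\<lambda>i. L (Poly_Mapping.single i 1 * p)) p"
    by (rule linear_eq_on_monomials[of "\<lambda>q. L (q * p)" _ p])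
      (auto intro: linear_coeff_pairing
         linear_compose[OF poly_mult_linear_right linear_coeff_pairing, unfolded o_def])
  also have "\<dots> = (\<Sum>i\<in>multi_indices n. \<Sum>j\<in>multi_indices n. ?l i * moment_matrix b i j * ?l j)"
    by (simp only: coeff_pairing_superset[OF finite_multi_indices keys] 1)
      (simp add: moment_matrix_def sum_distrib_left mult_ac)
  also have "\<dots> \<ge> 0" using psd by (simp add: psd_on_def)
  finally show ?thesis .
qed

text \<open>If \<open>q\<close> of degree at most \<open>n\<close> is congruent to \<open>p\<close>
  modulo the kernel, then \<open>L (p * p) - L (q * q) = L ((p + q) * (p - q))\<close> is 0.\<close>

lemma L_square_nonneg:
  assumes "deg_le p (Suc n)"
  shows "L (p * p) \<ge> 0"
proof -
  obtain q where q: "deg_le q n" "M q = M p" using flat_reduce[OF assms] .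
  have "deg_le (p + q) (Suc n)" using assms q(1) deg_le_mono deg_le_add by force
  moreover have "M (p - q) = 0" using q(2) by (simp add: M_simps)
  ultimately have "L ((p + q) * (p - q)) = 0" by (metis M_eq_0D)
  then have "L (p * p) = L (q * q)" by (simp add: algebra_simps L_simps)
  then show ?thesis using L_square_nonneg_n[OF q(1)] by simp
qed

lemma M_eq_0_if_L_square_0:
  assumes p: "deg_le p (Suc n)" and 0: "L (p * p) = 0"
  shows "M p = 0"
  unfolding column_comb_eq_0_iff
proof safe
  fix q :: "'n mpoly_real" assume q: "deg_le q (Suc n)"
  let ?a = "L (q * p)" and ?c = "L (q * q)"
  \<comment> \<open>Cauchy-Schwarz by nonnegativity of the square of \<open>p + t q\<close>; the 1 covers \<open>?c = 0\<close>.\<close>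
  define s where "s = 1 / (?c + 1)"
  define t where "t = - ?a * s"
  have c: "?c \<ge> 0" by (rule L_square_nonneg[OF q])
  have "deg_le (p + t *\<^sub>R q) (Suc n)" using p q by (intro deg_le_add deg_le_scale)
  then have "0 \<le> L ((p + t *\<^sub>R q) * (p + t *\<^sub>R q))" by (rule L_square_nonneg)
  have dbl: "(2 * t) *\<^sub>R (q * p) = t *\<^sub>R (q * p) + t *\<^sub>R (q * p)"
    by (metis mult_2 scaleR_add_left)
  note \<open>0 \<le> L ((p + t *\<^sub>R q) * (p + t *\<^sub>R q))\<close>
  also have "(p + t *\<^sub>R q) * (p + t *\<^sub>R q) = p * p + (2 * t) *\<^sub>R (q * p) + t\<^sup>2 *\<^sub>R (q * q)"
    by (simp only: bilinear_ladd[OF bilinear_poly_mult] bilinear_radd[OF bilinear_poly_mult]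
        bilinear_lmul[OF bilinear_poly_mult] bilinear_rmul[OF bilinear_poly_mult] mult.commute[of p q])
      (simp add: power2_eq_square scaleR_add_right dbl)
  also have "L \<dots> = 2 * t * ?a + t\<^sup>2 * ?c" by (simp add: L_simps 0)
  also have "\<dots> = ?a\<^sup>2 * s * (s * ?c - 2)"
    by (simp add: t_def power2_eq_square algebra_simps)
  finally have "?a\<^sup>2 * s * (2 - s * ?c) \<le> 0" by (simp add: algebra_simps)
  moreover have "s > 0" "s * ?c < 2" using c by (auto simp: s_def divide_simps)
  ultimately have "?a\<^sup>2 \<le> 0" by (simp add: mult_le_0_iff)
  then show "?a = 0" by simp
qed

text \<open>The spectral theorem for the operators that multiplication by the variables induces on a
  complement \<open>S\<close> of the kernel. The eigenvalue equations are passed on under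
  \<open>M\<close>, because they hold only modulo the kernel.\<close>

lemma joint_eigenbasis:
  obtains H v where "finite H" "card H = moment_rank n b"
    "\<And>h. h \<in> H \<Longrightarrow> deg_le h n"
    "\<And>h h'. h \<in> H \<Longrightarrow> h' \<in> H \<Longrightarrow> L (h * h') = (if h = h' then 1 else 0)"
    "\<And>h k. h \<in> H \<Longrightarrow> M (var k * h) = (v h $ k :: real) *\<^sub>R M h"
    "\<And>p. deg_le p (Suc n) \<Longrightarrow> M p = (\<Sum>h\<in>H. L (p * h) *\<^sub>R M h)"
proof -
  obtain g where g: "range g \<subseteq> {p. deg_le p n}" "linear g" "\<And>c. c \<in> M ` {p. deg_le p n} \<Longrightarrow> M (g c) = c"
    using linear_exists_right_inverse_on[OF linear_column_comb[of "Suc n" b] subspace_deg_le[of n]] by auto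
  \<comment> \<open>Since \<open>g\<close> is a linear section of \<open>M\<close>, \<open>\<pi>\<close> projects onto a complement of the kernel of \<open>M\<close>.\<close>
  define \<pi> where "\<pi> p = g (M p)" for p
  have lin\<pi>: "linear \<pi>"
    using linear_compose[OF linear_column_comb[of "Suc n" b] g(2)] by (simp add: \<pi>_def[abs_def] o_def)
  have deg\<pi>: "deg_le (\<pi> p) n" for p using g(1) by (auto simp: \<pi>_def)
  have M\<pi>: "M (\<pi> p) = M p" if "deg_le p (Suc n)" for p
    using flat_reduce[OF that] g(3) unfolding \<pi>_def by (metis imageI mem_Collect_eq)
  \<comment> \<open>\<open>\<pi> p\<close> and \<open>p\<close> differ by an element of the kernel,
    which the form does not see.\<close>
  have L\<pi>: "L (q * \<pi> p) = L (q * p)" "L (\<pi> p * q) = L (p * q)" if "deg_le p (Suc n)" "deg_le q (Suc n)" for p q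
  proof -
    have "M (\<pi> p - p) = 0" using M\<pi>[OF that(1)] by (simp add: M_simps)
    then have "L (q * (\<pi> p - p)) = 0" using M_eq_0D that(2) by blast
    then show "L (q * \<pi> p) = L (q * p)" by (simp add: algebra_simps L_simps)
    then show "L (\<pi> p * q) = L (p * q)" by (simp add: mult.commute)
  qed
  define S where "S = \<pi> ` {p. deg_le p (Suc n)}"
  have S: "subspace S" unfolding S_def by (intro linear_subspace_image[OF lin\<pi>] subspace_deg_le)
  have SD: "deg_le x n" "deg_le x (Suc n)" "\<pi> x = x" if "x \<in> S" for x
    using that deg\<pi> M\<pi> by (auto simp: S_def \<pi>_def intro: deg_le_mono[of _ n])
  define X where "X k p = \<pi> (var k * p)" for k p
  have linX: "linear (X k)" for k
    unfolding X_def[abs_def] by (rule linear_compose[OF poly_mult_linear_left lin\<pi>, unfolded o_def])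
  have XS: "X k ` S \<subseteq> S" for k
    using deg_le_var_mult SD(1) by (auto simp: X_def S_def)
  define B where "B p q = L (p * q)" for p q
  have B: "bilinear B"
    unfolding bilinear_def B_def
    by (auto intro: linear_compose[OF poly_mult_linear_left linear_coeff_pairing, unfolded o_def]
        linear_compose[OF poly_mult_linear_right linear_coeff_pairing, unfolded o_def])
  \<comment> \<open>A null vector of the form lies in the kernel of \<open>M\<close>, which
    \<open>\<pi>\<close> sends to 0 while fixing \<open>S\<close>.\<close>
  have B_pos: "B x x > 0" if "x \<in> S" "x \<noteq> 0" for x
  proof (rule ccontr)
    assume "\<not> B x x > 0"
    then have "L (x * x) = 0" using L_square_nonneg[OF SD(2)[OF that(1)]] by (simp add: B_def)
    then have "M x = 0" using M_eq_0_if_L_square_0 SD(2) that(1) by blast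
    then have "\<pi> x = 0" by (simp add: \<pi>_def linear_0[OF g(2)])
    then show False using SD(3) that by simp
  qed
  have sa: "B (X k x) y = B x (X k y)" if "x \<in> S" "y \<in> S" for k x y
  proof -
    have "B (X k x) y = L (var k * x * y)" "B x (X k y) = L (x * (var k * y))"
      using L\<pi>(2)[of "var k * x" y] L\<pi>(1)[of "var k * y" x] that
      by (simp_all only: B_def X_def deg_le_var_mult SD)
    then show ?thesis by (simp add: mult_ac)
  qed
  \<comment> \<open>A test polynomial of degree at most \<open>n\<close> absorbs the outer variable,
    after which the form no longer sees the inner projection; what remains is symmetric in
    \<open>k\<close> and \<open>l\<close>.\<close>
  have comm: "X k (X l x) = X l (X k x)" if "x \<in> S" for k l x
  proof -
    let ?u = "var k * \<pi> (var l * x) - var l * \<pi> (var k * x)"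
    have "M ?u = 0"
    proof (rule flat_kernel)
      show "deg_le ?u (Suc n)" by (intro deg_le_diff deg_le_var_mult deg\<pi>)
      fix q :: "'n mpoly_real" assume q: "deg_le q n"
      have *: "L (q * (var k * \<pi> (var l * x))) = L (q * (var k * (var l * x)))" for k l
        using L\<pi>(1)[OF deg_le_var_mult[OF SD(1)[OF that], where k = l] deg_le_var_mult[OF q, where k = k]]
        by (simp add: mult_ac)
      show "L (q * ?u) = 0"
        by (simp only: right_diff_distrib L_simps *) (simp add: mult_ac)
    qed
    then show ?thesis by (simp add: X_def \<pi>_def M_simps)
  qed
  have S_span: "S \<subseteq> span ((\<lambda>i. Poly_Mapping.single i 1) ` multi_indices n)"
    using SD(1) by (auto simp flip: deg_le_eq_span)
  have fin: "finite ((\<lambda>i. Poly_Mapping.single i (1::real)) ` multi_indices n :: 'n mpoly_real set)"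
    by (simp add: finite_multi_indices)
  have B_sym: "B x y = B y x" for x y by (simp add: B_def mult.commute)
  obtain H l where H: "finite H" "H \<subseteq> S"
    "\<And>h h'. h \<in> H \<Longrightarrow> h' \<in> H \<Longrightarrow> B h h' = (if h = h' then 1 else 0)"
    and l: "\<And>h k. h \<in> H \<Longrightarrow> X k h = l h k *\<^sub>R h"
    and ex: "\<And>x. x \<in> S \<Longrightarrow> x = (\<Sum>h\<in>H. B x h *\<^sub>R h)"
    by (rule commuting_selfadjoint_joint_eigenbasis[of X S _ B], rule linX, rule XS, rule S,
        rule S_span, rule fin, rule B, rule B_sym, rule B_pos, assumption+, rule sa, assumption+,
        rule comm, assumption, rule that, assumption+)
  have ev: "M (var k * h) = l h k *\<^sub>R M h" if "h \<in> H" for h k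
  proof -
    have "M (var k * h) = M (X k h)"
      using M\<pi>[of "var k * h"] deg_le_var_mult SD(1) H(2) that by (auto simp: X_def)
    then show ?thesis using l[OF that] by (simp add: M_simps)
  qed
  have exM: "M p = (\<Sum>h\<in>H. L (p * h) *\<^sub>R M h)" if p: "deg_le p (Suc n)" for p
  proof -
    have "M p = M (\<Sum>h\<in>H. B (\<pi> p) h *\<^sub>R h)" using ex[of "\<pi> p"] p M\<pi>[OF p] by (simp add: S_def)
    also have "\<dots> = (\<Sum>h\<in>H. B (\<pi> p) h *\<^sub>R M h)"
      by (simp add: linear_sum[OF linear_column_comb] M_simps)
    also have "\<dots> = (\<Sum>h\<in>H. L (p * h) *\<^sub>R M h)"
      using H(2) SD(2) p by (intro sum.cong) (auto simp: B_def L\<pi>)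
    finally show ?thesis .
  qed
  \<comment> \<open>The dimension count: \<open>g\<close> inverts \<open>M\<close> on
    \<open>S\<close>, so \<open>M\<close> maps \<open>H\<close> injectively to a basis of the column
    space.\<close>
  have "inj_on M S"
    by (rule inj_onI) (metis SD(3) \<pi>_def)
  moreover have "span H \<subseteq> S" using H(2) S by (simp add: span_minimal)
  ultimately have inj: "inj_on M (span H)" by (rule inj_on_subset)
  have "independent H" using B H(1,3) by (rule orthonormal_independent)
  then have "independent (M ` H)" using linear_independent_injective_image[OF linear_column_comb] inj by blast
  moreover have "span (M ` H) = span (moment_columns (Suc n) b)"
  proof
    have "M ` H \<subseteq> span (moment_columns (Suc n) b)"
      using H(2) SD(2) by (auto simp: span_moment_columns)
    then show "span (M ` H) \<subseteq> span (moment_columns (Suc n) b)" by (simp add: span_minimal)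
    show "span (moment_columns (Suc n) b) \<subseteq> span (M ` H)"
    proof
      fix x assume "x \<in> span (moment_columns (Suc n) b)"
      then obtain p where p: "deg_le p (Suc n)" "x = M p" by (auto simp: span_moment_columns)
      show "x \<in> span (M ` H)"
        unfolding p(2) exM[OF p(1)] by (intro span_sum span_scale span_base imageI)
    qed
  qed
  ultimately have "dim (moment_columns (Suc n) b) = card (M ` H)" by (metis dim_eq_card)
  also have "card (M ` H) = card H"
    using inj inj_on_subset span_superset by (intro card_image) blast
  finally have "card H = moment_rank n b" using flat by (simp add: moment_rank_def)
  \<comment> \<open>The joint eigenvalues of \<open>h\<close> are the coordinates of its
    node.\<close>
  then show thesis
  proof (rule that[of H "\<lambda>h. \<chi> k. l h k", OF H(1)])
    show "deg_le h n" if "h \<in> H" for h using H(2) SD(1) that by auto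
    show "L (h * h') = (if h = h' then 1 else 0)" if "h \<in> H" "h' \<in> H" for h h'
      using H(3) that by (simp add: B_def)
    show "M (var k * h) = (\<chi> k. l h k) $ k *\<^sub>R M h" if "h \<in> H" for h k
      using ev[OF that] by simp
    show "M p = (\<Sum>h\<in>H. L (p * h) *\<^sub>R M h)" if "deg_le p (Suc n)" for p
      by (rule exM[OF that])
  qed
qed

text \<open>The points of joint eigenvalues are the nodes of a quadrature rule. At the node of
  \<open>h\<close> the weight is \<open>(L h)\<^sup>2\<close>, and the interpolation polynomial is
  \<open>L h *\<^sub>R h\<close>.\<close>

lemma gauss_quadrature:
  defines "V \<equiv> moment_variety (Suc n) b"
  obtains \<rho> e where "finite V" "card V = moment_rank n b"
    "\<And>w. w \<in> V \<Longrightarrow> \<rho> w > (0::real)"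
    "\<And>w. w \<in> V \<Longrightarrow> deg_le (e w) n"
    "\<And>w w'. w \<in> V \<Longrightarrow> w' \<in> V \<Longrightarrow> eval_poly (e w) w' = (if w = w' then 1 else 0)"
    "\<And>p q. deg_le p (Suc n) \<Longrightarrow> deg_le q (Suc n)
      \<Longrightarrow> L (p * q) = (\<Sum>w\<in>V. \<rho> w * eval_poly p w * eval_poly q w)"
proof -
  obtain H v where H: "finite H" "card H = moment_rank n b"
    and deg: "\<And>h. h \<in> H \<Longrightarrow> deg_le h n"
    and on: "\<And>h h'. h \<in> H \<Longrightarrow> h' \<in> H \<Longrightarrow> L (h * h') = (if h = h' then 1 else 0)"
    and ev: "\<And>h k. h \<in> H \<Longrightarrow> M (var k * h) = (v h $ k :: real) *\<^sub>R M h"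
    and ex: "\<And>p. deg_le p (Suc n) \<Longrightarrow> M p = (\<Sum>h\<in>H. L (p * h) *\<^sub>R M h)"
    by (rule joint_eigenbasis, rule that, assumption+)
  \<comment> \<open>The coefficient of \<open>h\<close> in the expansion of the constant 1.\<close>
  define c where "c h = L h" for h
  have deg1: "deg_le h (Suc n)" if "h \<in> H" for h using deg[OF that] deg_le_mono by force
  have mon: "M (Poly_Mapping.single i 1) = (\<Sum>h\<in>H. (monomial i (v h) * c h) *\<^sub>R M h)"
    if "mdeg i \<le> Suc n" for i
    using that
  proof (induction "mdeg i" arbitrary: i)
    case 0
    then show ?case using ex[OF deg_le_one] by (simp add: c_def)
  next
    case (Suc m)
    from Suc.hyps(2)[symmetric] obtain k j where i: "i = axis k 1 + j" and j: "mdeg j = m"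
      by (rule mdeg_Suc_split)
    \<comment> \<open>The error of the expansion for the smaller monomial \<open>j\<close>. As its
      degree is at most \<open>n\<close>, its product with \<open>var k\<close> stays in the kernel,
      and the eigenvalue equations supply the missing factor \<open>v h $ k\<close>.\<close>
    define u where "u = Poly_Mapping.single j 1 - (\<Sum>h\<in>H. (monomial j (v h) * c h) *\<^sub>R h)"
    have "M u = 0"
      using Suc.hyps(1)[of j] j Suc.hyps(2) Suc.prems
      by (simp add: u_def M_simps linear_sum[OF linear_column_comb])
    moreover have "deg_le u n"
      unfolding u_def using deg j Suc.hyps(2) Suc.prems
      by (intro deg_le_diff deg_le_sum deg_le_scale deg_le_single) auto
    ultimately have "M (var k * u) = 0" by (rule flat_kernel_ideal[rotated])
    moreover have "var k * u = Poly_Mapping.single i 1 - (\<Sum>h\<in>H. (monomial j (v h) * c h) *\<^sub>R (var k * h))"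
      by (simp add: u_def i right_diff_distrib mult_single sum_distrib_left bilinear_rmul[OF bilinear_poly_mult])
    ultimately have "M (Poly_Mapping.single i 1) = (\<Sum>h\<in>H. (monomial j (v h) * c h) *\<^sub>R M (var k * h))"
      by (simp add: M_simps linear_sum[OF linear_column_comb])
    also have "\<dots> = (\<Sum>h\<in>H. (monomial i (v h) * c h) *\<^sub>R M h)"
      using ev by (intro sum.cong) (simp_all add: i monomial_add mult_ac del: One_nat_def)
    finally show ?case .
  qed
  have expand: "M p = (\<Sum>h\<in>H. (eval_poly p (v h) * c h) *\<^sub>R M h)" if "deg_le p (Suc n)" for p
  proof (rule linear_eq_on_monomials[of _ _ p])
    show "linear (\<lambda>p. \<Sum>h\<in>H. (eval_poly p (v h) * c h) *\<^sub>R M h)"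
      by (rule linearI) (simp_all add: linear_add[OF linear_eval_poly] linear_scale[OF linear_eval_poly]
          sum.distrib algebra_simps scaleR_sum_right)
    fix i assume "i \<in> Poly_Mapping.keys p"
    then show "M (Poly_Mapping.single i 1) = (\<Sum>h\<in>H. (eval_poly (Poly_Mapping.single i 1) (v h) * c h) *\<^sub>R M h)"
      using that mon by (simp add: deg_le_def)
  qed (rule linear_column_comb)
  have L_expand: "L (q * p) = (\<Sum>h\<in>H. eval_poly p (v h) * c h * L (q * h))"
    if "deg_le p (Suc n)" "deg_le q (Suc n)" for p q
  proof -
    have "M (p - (\<Sum>h\<in>H. (eval_poly p (v h) * c h) *\<^sub>R h)) = 0"
      using expand[OF that(1)] by (simp add: M_simps linear_sum[OF linear_column_comb])
    from M_eq_0D[OF this that(2)] show ?thesis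
      by (simp add: right_diff_distrib sum_distrib_left bilinear_rmul[OF bilinear_poly_mult]
          L_simps linear_sum[OF linear_coeff_pairing])
  qed
  have L_mult: "L (h * p) = eval_poly p (v h) * c h" if "deg_le p (Suc n)" "h \<in> H" for p h
  proof -
    have "L (h * p) = (\<Sum>h'\<in>H. if h = h' then eval_poly p (v h') * c h' else 0)"
      unfolding L_expand[OF that(1) deg1[OF that(2)]] using on that(2) by (intro sum.cong) auto
    then show ?thesis using that(2) H(1) by simp
  qed
  \<comment> \<open>\<open>L_mult\<close> for a basis element \<open>p\<close> expresses
    orthonormality through values at the nodes. Hence \<open>c h\<close> is nonzero and different
    basis elements have different nodes.\<close>
  have bio: "eval_poly h (v h') * c h' = (if h = h' then 1 else 0)" if "h \<in> H" "h' \<in> H" for h h'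
    using L_mult[OF deg1[OF that(1)] that(2)] on[OF that(2,1)] by auto
  have c0: "c h \<noteq> 0" if "h \<in> H" for h using bio[OF that that] by auto
  have inj: "inj_on v H"
  proof (rule inj_onI, rule ccontr)
    fix h h' assume "h \<in> H" "h' \<in> H" "v h = v h'" "h \<noteq> h'"
    then show False using bio[of h h'] bio[of h h] c0[of h'] by auto
  qed
  have V: "V = v ` H"
  proof
    show "v ` H \<subseteq> V"
      unfolding V_def moment_variety_def
    proof safe
      \<comment> \<open>The pairing of \<open>h\<close> with \<open>p\<close> is 0 and equals the
        value of \<open>p\<close> at the node times the nonzero \<open>c h\<close>.\<close>
      fix h p assume "h \<in> H" "deg_le p (Suc n)" "M p = 0"
      then show "eval_poly p (v h) = 0"
        using L_mult[of p h] M_eq_0D[of p h] deg1 c0 by simp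
    qed
    show "V \<subseteq> v ` H"
    proof
      fix x assume "x \<in> V"
      then have x: "eval_poly p x = 0" if "deg_le p (Suc n)" "M p = 0" for p
        using that by (auto simp: V_def moment_variety_def)
      \<comment> \<open>The expansion of 1 holds modulo the kernel, hence exactly at
        \<open>x\<close>, so some \<open>h\<close> does not vanish there.\<close>
      have "eval_poly (1 - (\<Sum>h\<in>H. c h *\<^sub>R h)) x = 0"
      proof (rule x)
        show "deg_le (1 - (\<Sum>h\<in>H. c h *\<^sub>R h)) (Suc n)"
          using deg1 by (intro deg_le_diff deg_le_sum deg_le_scale) auto
        show "M (1 - (\<Sum>h\<in>H. c h *\<^sub>R h)) = 0"
          using ex[OF deg_le_one] by (simp add: M_simps linear_sum[OF linear_column_comb] c_def)
      qed
      then have "(\<Sum>h\<in>H. c h * eval_poly h x) = 1"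
        by (simp add: linear_diff[OF linear_eval_poly] linear_sum[OF linear_eval_poly] linear_scale[OF linear_eval_poly])
      then obtain h where h: "h \<in> H" "eval_poly h x \<noteq> 0"
        by (metis (no_types, lifting) mult_zero_right sum.neutral zero_neq_one)
      \<comment> \<open>The eigenvalue equation also holds exactly at \<open>x\<close>, where
        \<open>h\<close> can be cancelled.\<close>
      have "x $ k = v h $ k" for k
      proof -
        have "eval_poly (var k * h - (v h $ k) *\<^sub>R h) x = 0"
          using ev[OF h(1)] deg[OF h(1)] deg1[OF h(1)]
          by (intro x deg_le_diff deg_le_scale deg_le_var_mult) (simp_all add: M_simps)
        then have "(x $ k - v h $ k) * eval_poly h x = 0"
          by (simp add: linear_diff[OF linear_eval_poly] linear_scale[OF linear_eval_poly]
              eval_poly_mult left_diff_distrib del: One_nat_def)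
        then show ?thesis using h(2) by simp
      qed
      then show "x \<in> v ` H" using h(1) by (auto simp: vec_eq_iff)
    qed
  qed
  define i where "i = the_inv_into H v"
  have i: "i (v h) = h" if "h \<in> H" for h using inj that by (simp add: i_def the_inv_into_f_f)
  show thesis
  proof (rule that[of "\<lambda>w. (c (i w))\<^sup>2" "\<lambda>w. c (i w) *\<^sub>R i w"])
    show "finite V" "card V = moment_rank n b" using H inj by (simp_all add: V card_image)
    show "(c (i w))\<^sup>2 > 0" "deg_le (c (i w) *\<^sub>R i w) n" if "w \<in> V" for w
      using that c0 deg by (auto simp: V i intro: deg_le_scale)
    show "eval_poly (c (i w) *\<^sub>R i w) w' = (if w = w' then 1 else 0)" if w: "w \<in> V" "w' \<in> V" for w w'
    proof -
      obtain h h' where h: "h \<in> H" "w = v h" "h' \<in> H" "w' = v h'" using w by (auto simp: V)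
      have "c h * eval_poly h (v h') = (if h = h' then 1 else 0)"
        using bio[OF h(1,3)] c0[OF h(3)] by (auto simp: mult_ac split: if_splits)
      then show ?thesis using h i inj by (auto simp: linear_scale[OF linear_eval_poly] dest: inj_onD)
    qed
    show "L (p * q) = (\<Sum>w\<in>V. (c (i w))\<^sup>2 * eval_poly p w * eval_poly q w)"
      if "deg_le p (Suc n)" "deg_le q (Suc n)" for p q
    proof -
      \<comment> \<open>First \<open>q\<close> is expanded, then each \<open>L (p * h)\<close> is
        read as a value of \<open>p\<close>; each of the two steps contributes a factor
        \<open>c h\<close>.\<close>
      have "L (p * q) = (\<Sum>h\<in>H. eval_poly q (v h) * c h * (eval_poly p (v h) * c h))"
        using L_expand[OF that(2,1)] L_mult[OF that(1)] by (simp add: mult.commute[of p])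
      also have "\<dots> = (\<Sum>h\<in>H. (c (i (v h)))\<^sup>2 * eval_poly p (v h) * eval_poly q (v h))"
        by (intro sum.cong) (simp_all add: i power2_eq_square)
      finally show ?thesis using inj by (simp add: V sum.reindex)
    qed
  qed
qed

end

section \<open>Representing measures\<close>

lemma finite_support_measure_eqI:
  fixes \<mu> \<nu> :: "'a::t1_space measure"
  assumes V: "finite V" and sets: "sets \<mu> = sets borel" "sets \<nu> = sets borel"
    and null: "emeasure \<mu> (- V) = 0" "emeasure \<nu> (- V) = 0"
    and eq: "\<And>w. w \<in> V \<Longrightarrow> emeasure \<mu> {w} = emeasure \<nu> {w}"
  shows "\<mu> = \<nu>"
proof -
  have *: "emeasure M A = (\<Sum>w\<in>A \<inter> V. emeasure M {w})"
    if "sets M = sets borel" "emeasure M (- V) = 0" "A \<in> sets borel" for M :: "'a measure" and A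
  proof -
    have V_closed: "V \<in> sets borel" using finite_imp_closed[OF V] by simp
    then have "- V \<in> null_sets M" using that by (intro null_setsI) auto
    then have "emeasure M A = emeasure M (A - (- V))"
      using that(1,3) by (simp add: emeasure_Diff_null_set[symmetric] del: Diff_Compl)
    also have "A - (- V) = A \<inter> V" by auto
    also have "emeasure M (A \<inter> V) = (\<Sum>w\<in>A \<inter> V. emeasure M {w})"
      using V that(1) by (intro emeasure_eq_sum_singleton) auto
    finally show ?thesis .
  qed
  show ?thesis
  proof (rule measure_eqI)
    fix A assume "A \<in> sets \<mu>"
    then have A: "A \<in> sets borel" using sets by simp
    show "emeasure \<mu> A = emeasure \<nu> A"
      using *[OF sets(1) null(1) A] *[OF sets(2) null(2) A] eq by simp
  qed (simp add: sets)
qed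

lemma integral_finite_support:
  fixes \<nu> :: "'a::t1_space measure" and f :: "'a \<Rightarrow> real"
  assumes V: "finite V" and sets: "sets \<nu> = sets borel" and null: "emeasure \<nu> (- V) = 0"
    and fin: "\<And>w. w \<in> V \<Longrightarrow> emeasure \<nu> {w} < \<infinity>" and f: "f \<in> borel_measurable borel"
  shows "integrable \<nu> f" and "integral\<^sup>L \<nu> f = (\<Sum>w\<in>V. measure \<nu> {w} * f w)"
proof -
  \<comment> \<open>A combination of indicators of points that equals \<open>f\<close> on
    \<open>V\<close> and 0 elsewhere, hence equals \<open>f\<close> almost everywhere.\<close>
  let ?g = "\<lambda>x. \<Sum>w\<in>V. f w * indicator {w} x"
  have space: "space \<nu> = UNIV" using sets_eq_imp_space_eq[OF sets] by simp
  have sing: "{w} \<in> sets \<nu>" for w using sets by simp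
  have int: "integrable \<nu> (\<lambda>x. f w * indicator {w} x)" if "w \<in> V" for w
    using fin[OF that] sing by (intro integrable_mult_right integrable_real_indicator) auto
  have g: "integrable \<nu> ?g" using int by (intro Bochner_Integration.integrable_sum) auto
  have fm: "f \<in> borel_measurable \<nu>" using f measurable_cong_sets[OF sets refl] by blast
  have "- V \<in> null_sets \<nu>"
    using finite_imp_closed[OF V] null sets by (intro null_setsI) (auto simp: borel_closed)
  moreover have "{x \<in> space \<nu>. ?g x \<noteq> f x} \<subseteq> - V"
    using V by (auto simp: indicator_def if_distrib cong: if_cong)
  ultimately have ae: "AE x in \<nu>. ?g x = f x" by (rule AE_I')
  show "integrable \<nu> f" using g fm ae by (rule integrable_cong_AE_imp)
  have "integral\<^sup>L \<nu> f = integral\<^sup>L \<nu> ?g"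
    using fm g ae by (intro integral_cong_AE) auto
  also have "\<dots> = (\<Sum>w\<in>V. integral\<^sup>L \<nu> (\<lambda>x. f w * indicator {w} x))"
    using int by (rule Bochner_Integration.integral_sum)
  also have "\<dots> = (\<Sum>w\<in>V. measure \<nu> {w} * f w)"
    by (intro sum.cong) (simp_all add: space)
  finally show "integral\<^sup>L \<nu> f = (\<Sum>w\<in>V. measure \<nu> {w} * f w)" .
qed

lemma atomic_measure_atoms:
  fixes v :: "nat \<Rightarrow> real ^ 'n"
  assumes v: "bij_betw v {..<r} V"
  shows "emeasure (atomic_measure r \<rho> v) (- V) = 0"
    and "\<And>j. j < r \<Longrightarrow> emeasure (atomic_measure r \<rho> v) {v j} = ennreal (vec_index \<rho> j)"
proof -
  have "finite V" using v bij_betw_finite by blast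
  then have "- V \<in> sets borel" using finite_imp_closed[of V] by (simp add: borel_open open_Compl)
  then show "emeasure (atomic_measure r \<rho> v) (- V) = 0"
    using bij_betwE[OF v] by (simp add: emeasure_atomic_measure)
  fix j assume j: "j < r"
  have "emeasure (atomic_measure r \<rho> v) {v j} = (\<Sum>l<r. ennreal (vec_index \<rho> l) * indicator {v j} (v l))"
    by (simp add: emeasure_atomic_measure)
  also have "\<dots> = (\<Sum>l<r. if l = j then ennreal (vec_index \<rho> l) else 0)"
    using bij_betw_imp_inj_on[OF v] j by (intro sum.cong) (auto simp: indicator_def dest: inj_onD)
  also have "\<dots> = ennreal (vec_index \<rho> j)" using j by simp
  finally show "emeasure (atomic_measure r \<rho> v) {v j} = ennreal (vec_index \<rho> j)" .
qed

lemma measure_support_finite: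
  fixes \<mu> :: "'a::t1_space measure"
  assumes "finite V" "sets \<mu> = sets borel" "emeasure \<mu> (- V) = 0" "\<And>w. w \<in> V \<Longrightarrow> emeasure \<mu> {w} > 0"
  shows "measure_support \<mu> = V"
proof
  show "measure_support \<mu> \<subseteq> V"
    using finite_imp_closed[OF assms(1)] assms(3) by (fastforce simp: measure_support_def open_Compl)
  show "V \<subseteq> measure_support \<mu>"
    unfolding measure_support_def
  proof safe
    fix w U assume "w \<in> V" "open U" "w \<in> U"
    then have "emeasure \<mu> {w} \<le> emeasure \<mu> U" using assms(2) by (intro emeasure_mono) auto
    then show "emeasure \<mu> U > 0" using assms(4)[OF \<open>w \<in> V\<close>] by order
  qed
qed

section \<open>Integrals of polynomials against representing measures\<close>

lemma representing_measure_eval_poly: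
  fixes p :: "'n::finite mpoly_real"
  assumes \<nu>: "representing_measure m b \<nu>" and p: "deg_le p (2 * m)"
  shows "integrable \<nu> (eval_poly p)" and "integral\<^sup>L \<nu> (eval_poly p) = coeff_pairing b p"
proof -
  have i: "integrable \<nu> (monomial i)" "b i = integral\<^sup>L \<nu> (monomial i)" if "i \<in> Poly_Mapping.keys p" for i
    using \<nu> p that by (auto simp: representing_measure_def deg_le_def multi_indices_def)
  have int: "integrable \<nu> (\<lambda>t. Poly_Mapping.lookup p i * monomial i t)" if "i \<in> Poly_Mapping.keys p" for i
    using i(1)[OF that] by (rule integrable_mult_right)
  show "integrable \<nu> (eval_poly p)"
    unfolding eval_poly_def[abs_def] using int by (rule Bochner_Integration.integrable_sum)
  show "integral\<^sup>L \<nu> (eval_poly p) = coeff_pairing b p"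
    unfolding eval_poly_def[abs_def] coeff_pairing_def
    using int i by (simp add: Bochner_Integration.integral_sum)
qed

lemma borel_measurable_eval_poly [measurable]: "eval_poly p \<in> borel_measurable borel"
  unfolding eval_poly_def[abs_def] by measurable

context flat_moments
begin

text \<open>Describes representing measures by their null set and point masses, which yields
  existence and uniqueness together. A representing measure lives on \<open>V\<close> because
  polynomials of degree at most \<open>n + 1\<close> vanishing on \<open>V\<close> vanish almost
  everywhere.\<close>

lemma representing_measure_iff:
  defines "V \<equiv> moment_variety (Suc n) b"
  obtains \<rho> where "finite V" "card V = moment_rank n b" "\<And>w. w \<in> V \<Longrightarrow> \<rho> w > (0::real)"
    "\<And>\<nu>. representing_measure (Suc n) b \<nu> \<longleftrightarrow>
      sets \<nu> = sets borel \<and> emeasure \<nu> (- V) = 0 \<and> (\<forall>w\<in>V. emeasure \<nu> {w} = ennreal (\<rho> w))"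
    "\<And>p q. deg_le p (Suc n) \<Longrightarrow> deg_le q (Suc n)
      \<Longrightarrow> L (p * q) = (\<Sum>w\<in>V. \<rho> w * eval_poly p w * eval_poly q w)"
proof -
  obtain \<rho> e where V: "finite V" "card V = moment_rank n b"
    and pos: "\<And>w. w \<in> V \<Longrightarrow> \<rho> w > (0::real)"
    and deg_e: "\<And>w. w \<in> V \<Longrightarrow> deg_le (e w) n"
    and e: "\<And>w w'. w \<in> V \<Longrightarrow> w' \<in> V \<Longrightarrow> eval_poly (e w) w' = (if w = w' then 1 else 0)"
    and quad: "\<And>p q. deg_le p (Suc n) \<Longrightarrow> deg_le q (Suc n)
      \<Longrightarrow> L (p * q) = (\<Sum>w\<in>V. \<rho> w * eval_poly p w * eval_poly q w)"
    by (rule gauss_quadrature[folded V_def], rule that, assumption+)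
  have deg_e': "deg_le (e w) (Suc n)" if "w \<in> V" for w using deg_e[OF that] deg_le_mono by force
  have "representing_measure (Suc n) b \<nu> \<longleftrightarrow>
      sets \<nu> = sets borel \<and> emeasure \<nu> (- V) = 0 \<and> (\<forall>w\<in>V. emeasure \<nu> {w} = ennreal (\<rho> w))" for \<nu>
  proof
    assume \<nu>: "representing_measure (Suc n) b \<nu>"
    then have sets: "sets \<nu> = sets borel" by (simp add: representing_measure_def)
    have space: "space \<nu> = UNIV" using sets_eq_imp_space_eq[OF sets] by simp
    \<comment> \<open>The square of \<open>p\<close> is nonnegative with integral
      \<open>L (p * p)\<close>, which is 0 by quadrature.\<close>
    have ae: "AE x in \<nu>. eval_poly p x = 0"
      if "deg_le p (Suc n)" "\<And>w. w \<in> V \<Longrightarrow> eval_poly p w = 0" for p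
    proof -
      have deg: "deg_le (p * p) (2 * Suc n)" using deg_le_mult[OF that(1,1)] by (simp only: mult_2)
      have "L (p * p) = 0" using quad[OF that(1,1)] that(2) by simp
      then have "AE x in \<nu>. eval_poly (p * p) x = 0"
        using representing_measure_eval_poly[OF \<nu> deg] integral_nonneg_eq_0_iff_AE[of \<nu> "eval_poly (p * p)"]
        by (simp add: eval_poly_mult)
      then show ?thesis by (simp add: eval_poly_mult)
    qed
    \<comment> \<open>These finitely many polynomials and \<open>1 - (\<Sum>w\<in>V. e w)\<close>
      vanish on \<open>V\<close> and have no other common zero: where some \<open>e w\<close> is
      nonzero, the point must be \<open>w\<close>.\<close>
    have "AE x in \<nu>. \<forall>w\<in>V. \<forall>k. eval_poly (var k * e w - (w $ k) *\<^sub>R e w) x = 0"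
    proof (intro AE_finite_allI V ballI)
      fix w assume w: "w \<in> V"
      have "AE x in \<nu>. eval_poly (var k * e w - (w $ k) *\<^sub>R e w) x = 0" for k
      proof (rule ae)
        show "deg_le (var k * e w - (w $ k) *\<^sub>R e w) (Suc n)"
          using w deg_e deg_e' by (intro deg_le_diff deg_le_scale deg_le_var_mult) auto
        fix w' assume "w' \<in> V"
        then show "eval_poly (var k * e w - (w $ k) *\<^sub>R e w) w' = 0"
          using w e by (simp add: linear_diff[OF linear_eval_poly] linear_scale[OF linear_eval_poly]
              eval_poly_mult del: One_nat_def)
      qed
      then show "AE x in \<nu>. \<forall>k. eval_poly (var k * e w - (w $ k) *\<^sub>R e w) x = 0"
        by (simp add: AE_all_countable)
    qed
    moreover have "AE x in \<nu>. eval_poly (1 - (\<Sum>w\<in>V. e w)) x = 0"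
    proof (rule ae)
      show "deg_le (1 - (\<Sum>w\<in>V. e w)) (Suc n)" using deg_e' by (intro deg_le_diff deg_le_sum) auto
      fix w assume "w \<in> V"
      then have "(\<Sum>w'\<in>V. eval_poly (e w') w) = (\<Sum>w'\<in>V. if w' = w then 1 else 0)"
        using e by (intro sum.cong) auto
      then show "eval_poly (1 - (\<Sum>w\<in>V. e w)) w = 0" using V \<open>w \<in> V\<close>
        by (simp add: linear_diff[OF linear_eval_poly] linear_sum[OF linear_eval_poly])
    qed
    ultimately have "AE x in \<nu>. \<not> x \<notin> V"
    proof eventually_elim
      case (elim x)
      from elim(2) have "(\<Sum>w\<in>V. eval_poly (e w) x) = 1"
        by (simp add: linear_diff[OF linear_eval_poly] linear_sum[OF linear_eval_poly])
      then obtain w where w: "w \<in> V" "eval_poly (e w) x \<noteq> 0"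
        by (metis (no_types, lifting) sum.neutral zero_neq_one)
      have "eval_poly (var k * e w - (w $ k) *\<^sub>R e w) x = 0" for k using elim(1) w(1) by blast
      then have "(x $ k - w $ k) * eval_poly (e w) x = 0" for k
        by (simp add: linear_diff[OF linear_eval_poly] linear_scale[OF linear_eval_poly]
              eval_poly_mult left_diff_distrib del: One_nat_def)
      then have "x = w" using w(2) by (simp add: vec_eq_iff)
      then show ?case using w(1) by simp
    qed
    then have null: "emeasure \<nu> (- V) = 0"
      using emeasure_eq_0_AE[of "\<lambda>x. x \<notin> V" \<nu>] by (simp add: space Compl_eq)
    \<comment> \<open>Integrability of the constant 1 makes \<open>\<nu>\<close> finite.\<close>
    have "integrable \<nu> (monomial 0)"
      using \<nu> by (auto simp: representing_measure_def multi_indices_def)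
    moreover have "monomial (0 :: nat ^ 'n) = (\<lambda>x. 1)" by (rule ext) simp
    ultimately have "integrable \<nu> (\<lambda>x. 1 :: real)" by (simp only:)
    then have "emeasure \<nu> (space \<nu>) \<noteq> \<infinity>" by (simp add: integrable_iff_bounded less_top)
    then interpret finite_measure \<nu> by (rule finite_measureI)
    \<comment> \<open>The integral of \<open>e w\<close> is the mass of \<open>w\<close>, since
      \<open>\<nu>\<close> lives on \<open>V\<close>, and it is \<open>L (e w)\<close>, which
      quadrature evaluates to \<open>\<rho> w\<close>.\<close>
    have "emeasure \<nu> {w} = ennreal (\<rho> w)" if w: "w \<in> V" for w
    proof -
      have "measure \<nu> {w} = (\<Sum>w'\<in>V. if w' = w then measure \<nu> {w'} else 0)"
        using V w by simp
      also have "\<dots> = (\<Sum>w'\<in>V. measure \<nu> {w'} * eval_poly (e w) w')"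
        using e w by (intro sum.cong) auto
      also have "\<dots> = integral\<^sup>L \<nu> (eval_poly (e w))"
        by (rule integral_finite_support(2)[symmetric, OF V(1) sets null])
          (auto simp: emeasure_eq_measure)
      also have "\<dots> = L (e w * 1)"
        using representing_measure_eval_poly(2)[OF \<nu>, of "e w"] deg_le_mono[OF deg_e[OF w]] by simp
      also have "\<dots> = (\<Sum>w'\<in>V. \<rho> w' * eval_poly (e w) w')"
        unfolding quad[OF deg_e'[OF w] deg_le_one] by simp
      also have "\<dots> = (\<Sum>w'\<in>V. if w' = w then \<rho> w' else 0)"
        using e w by (intro sum.cong) auto
      also have "\<dots> = \<rho> w" using V w by simp
      finally show ?thesis by (simp add: emeasure_eq_measure)
    qed
    then show "sets \<nu> = sets borel \<and> emeasure \<nu> (- V) = 0 \<and> (\<forall>w\<in>V. emeasure \<nu> {w} = ennreal (\<rho> w))"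
      using sets null by blast
  next
    assume "sets \<nu> = sets borel \<and> emeasure \<nu> (- V) = 0 \<and> (\<forall>w\<in>V. emeasure \<nu> {w} = ennreal (\<rho> w))"
    then have \<nu>: "sets \<nu> = sets borel" "emeasure \<nu> (- V) = 0" "\<And>w. w \<in> V \<Longrightarrow> emeasure \<nu> {w} = ennreal (\<rho> w)"
      by auto
    have fin: "emeasure \<nu> {w} < \<infinity>" if "w \<in> V" for w using \<nu>(3)[OF that] by simp
    have meas: "measure \<nu> {w} = \<rho> w" if "w \<in> V" for w
      using \<nu>(3)[OF that] pos[OF that] by (simp add: measure_def)
    have "integrable \<nu> (monomial i)" "b i = integral\<^sup>L \<nu> (monomial i)" if "i \<in> multi_indices (2 * Suc n)" for i
    proof -
      have "mdeg i \<le> Suc n + Suc n" using that by (simp add: multi_indices_def)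
      then obtain j l where jl: "i = j + l" "mdeg j \<le> Suc n" "mdeg l \<le> Suc n"
        by (rule mdeg_le_add_split)
      have "b i = L (Poly_Mapping.single j 1 * Poly_Mapping.single l 1)"
        by (simp add: mult_single jl(1))
      also have "\<dots> = (\<Sum>w\<in>V. measure \<nu> {w} * monomial i w)"
        unfolding quad[OF deg_le_single[OF jl(2)] deg_le_single[OF jl(3)]]
        by (intro sum.cong) (simp_all add: meas jl(1) monomial_add)
      also have "\<dots> = integral\<^sup>L \<nu> (monomial i)"
        by (rule integral_finite_support(2)[symmetric, OF V(1) \<nu>(1,2) fin]) auto
      finally show "b i = integral\<^sup>L \<nu> (monomial i)" .
      show "integrable \<nu> (monomial i)"
        by (rule integral_finite_support(1)[OF V(1) \<nu>(1,2) fin]) auto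
    qed
    then show "representing_measure (Suc n) b \<nu>" using \<nu>(1) by (simp add: representing_measure_def)
  qed
  then show thesis using that[of \<rho>] V pos quad by blast
qed

end

section \<open>Invertibility of the matrix of monomials at the nodes\<close>

lemma mat_inverse_mult_vec:
  fixes A :: "real Matrix.mat"
  assumes A: "A \<in> carrier_mat r r" and det: "Determinant.det A \<noteq> 0"
  shows "invertible_mat A"
    and "x \<in> carrier_vec r \<Longrightarrow> the (mat_inverse A) *\<^sub>v (A *\<^sub>v x) = x"
proof -
  have "mat_inverse A \<noteq> None"
    using mat_inverse(1)[OF A, of "()"] det_non_zero_imp_unit[OF A det, of "()"] by blast
  then obtain B where B: "mat_inverse A = Some B" by blast
  note AB = mat_inverse(2)[OF A B]
  then show "invertible_mat A"
    using A by (auto simp: invertible_mat_def inverts_mat_def square_mat.simps intro!: exI[of _ B])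
  show "the (mat_inverse A) *\<^sub>v (A *\<^sub>v x) = x" if "x \<in> carrier_vec r"
  proof -
    have "B *\<^sub>v (A *\<^sub>v x) = (B * A) *\<^sub>v x"
      using AB A that by (intro assoc_mult_mat_vec[symmetric]) auto
    then show ?thesis using AB that by (simp add: B)
  qed
qed

text \<open>A relation between the rows of a singular \<open>W_matrix\<close> is a combination of
  the monomials \<open>i k\<close> that vanishes on \<open>V\<close>. It would lie in the kernel and
  give a relation between independent columns.\<close>

lemma W_matrix_det_nonzero:
  fixes b :: "nat ^ 'n \<Rightarrow> real"
  assumes V: "\<And>p :: 'n mpoly_real. deg_le p n \<Longrightarrow> (\<And>w. w \<in> V \<Longrightarrow> eval_poly p w = 0) \<Longrightarrow> column_comb n b p = 0"
    and v: "v ` {..<r} = V"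
    and i: "max_indep_columns n b r i"
  shows "Determinant.det (W_matrix r i v) \<noteq> 0"
proof
  let ?W = "W_matrix r i v"
  let ?f = "\<lambda>k. moment_column n b (i k)"
  have W: "?W \<in> carrier_mat r r" by (simp add: W_matrix_def)
  assume "Determinant.det ?W = 0"
  \<comment> \<open>Transposing turns a kernel vector into a relation between rows.\<close>
  then have "Determinant.det (transpose_mat ?W) = 0" by (simp add: Determinant.det_transpose[OF W])
  then obtain a where a: "a \<in> carrier_vec r" "a \<noteq> 0\<^sub>v r" and 0: "transpose_mat ?W *\<^sub>v a = 0\<^sub>v r"
    using det_0_iff_vec_prod_zero_field[of "transpose_mat ?W" r] W by auto
  define p :: "'n mpoly_real" where "p = (\<Sum>k<r. vec_index a k *\<^sub>R Poly_Mapping.single (i k) 1)"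
  have eval_p: "eval_poly p w = (\<Sum>k<r. vec_index a k * monomial (i k) w)" for w
    by (simp add: p_def linear_sum[OF linear_eval_poly] linear_scale[OF linear_eval_poly])
  have i_in: "\<And>k. k < r \<Longrightarrow> i k \<in> multi_indices n" and inj: "inj_on ?f {..<r}"
    and ind: "independent (?f ` {..<r})"
    using i by (auto simp: max_indep_columns_def Let_def)
  have "deg_le p n"
  proof -
    have "p \<in> {p. deg_le p n}"
      unfolding p_def using i_in
      by (intro subspace_sum subspace_scale subspace_deg_le) (auto simp: multi_indices_def deg_le_single)
    then show ?thesis by simp
  qed
  moreover have "eval_poly p w = 0" if w: "w \<in> V" for w
  proof -
    obtain j where j: "j < r" "w = v j" using w v by auto
    have "0 = vec_index (transpose_mat ?W *\<^sub>v a) j" using 0 j by simp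
    also have "\<dots> = (\<Sum>k<r. vec_index a k * monomial (i k) w)"
      using j a(1) by (simp add: W_matrix_def scalar_prod_def lessThan_atLeast0 mult.commute)
    finally show ?thesis by (simp add: eval_p)
  qed
  ultimately have "column_comb n b p = 0" by (rule V)
  then have "(\<Sum>k<r. vec_index a k *\<^sub>R ?f k) = 0"
    by (simp add: p_def linear_sum[OF linear_column_comb] linear_scale[OF linear_column_comb])
  \<comment> \<open>As the family of columns is injective, its coefficients become a function of the
    column, the form that \<open>independentD\<close> expects.\<close>
  then have sum0: "(\<Sum>c\<in>?f ` {..<r}. vec_index a (the_inv_into {..<r} ?f c) *\<^sub>R c) = 0"
    by (simp add: sum.reindex[OF inj] the_inv_into_f_f[OF inj])
  have "vec_index a k = 0" if "k < r" for k
    using independentD[OF ind _ subset_refl sum0, of "?f k"] that by (simp add: the_inv_into_f_f[OF inj])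
  then have "a = 0\<^sub>v r" using a(1) by (intro eq_vecI) auto
  then show False using a(2) by simp
qed

section \<open>The representing measure of a flat extension and its weights\<close>

theorem theorem1p2:
  fixes n r :: nat
    and \<beta> \<beta>' :: "nat ^ 'n \<Rightarrow> real"
    and V :: "(real ^ 'n) set"
  assumes psd: "psd_on (multi_indices n) (moment_matrix \<beta>)"
    and flat: "flat_extension n \<beta> \<beta>'"
    and r: "r = moment_rank n \<beta>"
    and V: "V = moment_variety (n + 1) \<beta>'"
  shows "finite V \<and> card V = r \<and>
    (\<exists>\<mu>. representing_measure (n + 1) \<beta>' \<mu> \<and>
         (\<forall>\<nu>. representing_measure (n + 1) \<beta>' \<nu> \<longrightarrow> \<nu> = \<mu>) \<and>
         measure_support \<mu> = V \<and>
         (\<forall>v i. bij_betw v {..<r} V \<and> max_indep_columns n \<beta> r i \<longrightarrow>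
            invertible_mat (W_matrix r i v) \<and>
            (\<forall>\<rho>\<in>carrier_vec r.
               (\<forall>j<r. 0 \<le> vec_index \<rho> j) \<and> \<mu> = atomic_measure r \<rho> v \<longleftrightarrow>
               \<rho> = the (mat_inverse (W_matrix r i v)) *\<^sub>v Matrix.vec r (\<lambda>k. \<beta> (i k)))))"
proof -
  \<comment> \<open>Entries of \<open>M(n)\<close> have degree at most \<open>2 * n\<close>, where
    both sequences agree; so its columns, rank and positivity carry over to
    \<open>\<beta>'\<close>.\<close>
  have \<beta>': "\<beta>' (i + j) = \<beta> (i + j)" if "i \<in> multi_indices n" "j \<in> multi_indices n" for i j
    using flat that by (auto simp: flat_extension_def multi_indices_def mdeg_add)
  have col: "moment_column n \<beta>' j = moment_column n \<beta> j" if "j \<in> multi_indices n" for j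
    by (rule poly_mapping_eqI) (simp add: moment_column.rep_eq moment_matrix_def \<beta>' that)
  have rank: "moment_rank n \<beta>' = moment_rank n \<beta>"
    using col by (simp add: moment_rank_def moment_columns_def cong: image_cong)
  interpret flat_moments n \<beta>'
  proof
    show "moment_rank (Suc n) \<beta>' = moment_rank n \<beta>'" using flat rank by (simp add: flat_extension_def)
    show "psd_on (multi_indices n) (moment_matrix \<beta>')"
      using psd by (simp add: psd_on_def moment_matrix_def \<beta>')
  qed
  have V': "moment_variety (Suc n) \<beta>' = V" using V by simp
  obtain \<rho> where fin: "finite V" and card: "card V = r" and pos: "\<And>w. w \<in> V \<Longrightarrow> \<rho> w > (0::real)"
    and rep: "\<And>\<nu>. representing_measure (Suc n) \<beta>' \<nu> \<longleftrightarrow>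
      sets \<nu> = sets borel \<and> emeasure \<nu> (- V) = 0 \<and> (\<forall>w\<in>V. emeasure \<nu> {w} = ennreal (\<rho> w))"
    and quad: "\<And>p q. deg_le p (Suc n) \<Longrightarrow> deg_le q (Suc n)
      \<Longrightarrow> L (p * q) = (\<Sum>w\<in>V. \<rho> w * eval_poly p w * eval_poly q w)"
    by (rule representing_measure_iff[unfolded V' rank, folded r], rule that, assumption+)
  \<comment> \<open>Proved for every enumeration \<open>v\<close> of \<open>V\<close>, because
    \<open>\<mu>\<close> is fixed before \<open>v\<close> is given; \<open>unique\<close> then
    identifies the measures obtained.\<close>
  have rep_atomic: "representing_measure (Suc n) \<beta>' (atomic_measure r (Matrix.vec r (\<lambda>j. \<rho> (v j))) v)"
    if "bij_betw v {..<r} V" for v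
    using atomic_measure_atoms[OF that] bij_betw_imp_surj_on[OF that]
    by (auto simp: rep sets_atomic_measure)
  have unique: "\<nu> = \<mu>" if "representing_measure (Suc n) \<beta>' \<mu>" "representing_measure (Suc n) \<beta>' \<nu>" for \<mu> \<nu>
    using that fin by (intro finite_support_measure_eqI[of V]) (auto simp: rep)
  obtain v0 where v0: "bij_betw v0 {..<r} V"
    using ex_bij_betw_nat_finite[OF fin] card by (auto simp: lessThan_atLeast0)
  define \<mu> where "\<mu> = atomic_measure r (Matrix.vec r (\<lambda>j. \<rho> (v0 j))) v0"
  have \<mu>: "representing_measure (Suc n) \<beta>' \<mu>" unfolding \<mu>_def by (rule rep_atomic[OF v0])
  have supp: "measure_support \<mu> = V"
    using \<mu> pos by (intro measure_support_finite[OF fin]) (auto simp: rep)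
  have vanish: "column_comb n \<beta>' p = 0" if "deg_le p n" "\<And>w. w \<in> V \<Longrightarrow> eval_poly p w = 0" for p
    unfolding column_comb_eq_0_iff
  proof safe
    fix q :: "'n mpoly_real" assume "deg_le q n"
    then have "deg_le q (Suc n)" "deg_le p (Suc n)" using that(1) deg_le_mono by force+
    then show "L (q * p) = 0" using quad that(2) by simp
  qed
  have main: "invertible_mat (W_matrix r i v) \<and> (\<forall>\<sigma>\<in>carrier_vec r.
      (\<forall>j<r. 0 \<le> vec_index \<sigma> j) \<and> \<mu> = atomic_measure r \<sigma> v \<longleftrightarrow>
      \<sigma> = the (mat_inverse (W_matrix r i v)) *\<^sub>v Matrix.vec r (\<lambda>k. \<beta> (i k)))"
    if v: "bij_betw v {..<r} V" and i: "max_indep_columns n \<beta> r i" for v i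
  proof -
    let ?W = "W_matrix r i v" and ?\<sigma> = "Matrix.vec r (\<lambda>j. \<rho> (v j))"
    have W: "?W \<in> carrier_mat r r" by (simp add: W_matrix_def)
    have i_in: "i k \<in> multi_indices n" if "k < r" for k
      using i that by (simp add: max_indep_columns_def)
    have "moment_columns n \<beta>' = moment_columns n \<beta>"
      unfolding moment_columns_def using col by (intro image_cong) auto
    moreover have "(\<lambda>k. moment_column n \<beta>' (i k)) ` {..<r} = (\<lambda>k. moment_column n \<beta> (i k)) ` {..<r}"
      using i_in col by (intro image_cong) auto
    moreover have "inj_on (\<lambda>k. moment_column n \<beta>' (i k)) {..<r} = inj_on (\<lambda>k. moment_column n \<beta> (i k)) {..<r}"
      using i_in col by (intro inj_on_cong) auto
    ultimately have "max_indep_columns n \<beta>' r i"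
      using i by (simp add: max_indep_columns_def)
    then have det: "Determinant.det ?W \<noteq> 0"
      using W_matrix_det_nonzero[of n V \<beta>'] vanish bij_betw_imp_surj_on[OF v] by blast
    \<comment> \<open>Row \<open>k\<close> is the quadrature formula for the product of the monomial
      \<open>i k\<close> and 1.\<close>
    have "?W *\<^sub>v ?\<sigma> = Matrix.vec r (\<lambda>k. \<beta> (i k))"
    proof (rule eq_vecI)
      fix k assume "k < dim_vec (Matrix.vec r (\<lambda>k. \<beta> (i k)))"
      then have k: "k < r" by simp
      have "mdeg (i k) \<le> Suc n" using i_in[OF k] by (simp add: multi_indices_def)
      then have "\<beta>' (i k) = (\<Sum>w\<in>V. \<rho> w * monomial (i k) w)"
        using quad[of "Poly_Mapping.single (i k) 1" "Poly_Mapping.single 0 1"]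
        by (simp add: deg_le_single mult_single)
      also have "\<dots> = (\<Sum>j<r. \<rho> (v j) * monomial (i k) (v j))"
        by (rule sum.reindex_bij_betw[OF v, symmetric])
      also have "\<dots> = vec_index (?W *\<^sub>v ?\<sigma>) k"
        using k by (simp add: W_matrix_def scalar_prod_def lessThan_atLeast0 mult.commute)
      finally show "vec_index (?W *\<^sub>v ?\<sigma>) k = vec_index (Matrix.vec r (\<lambda>k. \<beta> (i k))) k"
        using \<beta>'[OF i_in[OF k], of 0] k by (simp add: multi_indices_def)
    qed (simp add: W_matrix_def)
    then have sol: "the (mat_inverse ?W) *\<^sub>v Matrix.vec r (\<lambda>k. \<beta> (i k)) = ?\<sigma>"
      using mat_inverse_mult_vec(2)[OF W det, of ?\<sigma>] by simp
    have "(\<forall>j<r. 0 \<le> vec_index \<sigma> j) \<and> \<mu> = atomic_measure r \<sigma> v \<longleftrightarrow> \<sigma> = ?\<sigma>"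
      if \<sigma>: "\<sigma> \<in> carrier_vec r" for \<sigma>
    proof
      assume *: "(\<forall>j<r. 0 \<le> vec_index \<sigma> j) \<and> \<mu> = atomic_measure r \<sigma> v"
      show "\<sigma> = ?\<sigma>"
      proof (rule eq_vecI)
        fix j assume "j < dim_vec ?\<sigma>"
        then have j: "j < r" by simp
        then have "v j \<in> V" using v by (auto simp: bij_betw_def)
        then have "ennreal (\<rho> (v j)) = emeasure \<mu> {v j}" using \<mu> by (simp add: rep)
        also have "\<dots> = ennreal (vec_index \<sigma> j)"
          using * atomic_measure_atoms(2)[OF v j] by simp
        \<comment> \<open>\<open>ennreal\<close> is injective on nonnegative reals, so the sign
          condition on \<open>\<sigma>\<close> allows its entries to be recovered from the
          masses.\<close>
        finally show "vec_index \<sigma> j = vec_index ?\<sigma> j"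
          using * j pos[OF \<open>v j \<in> V\<close>] by (simp add: ennreal_inj less_imp_le)
      qed (use \<sigma> in simp)
    next
      assume "\<sigma> = ?\<sigma>"
      moreover have "\<rho> (v j) \<ge> 0" if "j < r" for j
        using pos v that by (auto simp: bij_betw_def less_imp_le)
      ultimately show "(\<forall>j<r. 0 \<le> vec_index \<sigma> j) \<and> \<mu> = atomic_measure r \<sigma> v"
        using unique[OF rep_atomic[OF v] \<mu>] by simp
    qed
    then show ?thesis using mat_inverse_mult_vec(1)[OF W det] by (simp add: sol)
  qed
  have "representing_measure (n + 1) \<beta>' \<mu>" using \<mu> by simp
  moreover have "\<forall>\<nu>. representing_measure (n + 1) \<beta>' \<nu> \<longrightarrow> \<nu> = \<mu>"
    unfolding Suc_eq_plus1[symmetric] using unique[OF \<mu>] by blast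
  ultimately show ?thesis using fin card supp main by blast
qed

end
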